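(* There is a constant $C(\underline{d})$, depending only on $\underline{d}$ and $k$, such that the Zariski closure of $Z(k)$ in $Z$ has codimension $\le C(\underline{d})$.
   Context: Let $k$ be an infinite Brauer field, i.e. an infinite field such that for every $d \ge 1$ there is a quantity $N_k(d)$ such that any equation $a_1 x_1^d + \cdots + a_n x_n^d = 0$ with $n > N_k(d)$ and $a_i \in k$ has a non-trivial solution in $k$. Let $\underline{f}=(f_1,\ldots,f_r)$ be homogeneous polynomials on a finite-dimensional $k$-vector space $V$ of degrees $\underline{d}=(d_1,\ldots,d_r)$, and let $Z=Z(\underline{f})$ be the closed subvariety of $V$ defined by the vanishing of the $f_i$. *)

theory Defs
  imports Main "HOL-Library.Poly_Mapping"
begin

text \<open>Multivariate polynomials over a field 'k in variables x_0, x_1, ...: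
  finitely supported maps from monomials (exponent vectors) to coefficients.
  Multiplication is the convolution product from Poly_Mapping.\<close>

type_synonym 'k mpoly = "(nat \<Rightarrow>\<^sub>0 nat) \<Rightarrow>\<^sub>0 'k"

definition mon_deg :: "(nat \<Rightarrow>\<^sub>0 nat) \<Rightarrow> nat" where
  "mon_deg m = (\<Sum>i\<in>Poly_Mapping.keys m. Poly_Mapping.lookup m i)"

definition mpoly_vars :: "'k::zero mpoly \<Rightarrow> nat set" where
  "mpoly_vars p = (\<Union>m\<in>Poly_Mapping.keys p. Poly_Mapping.keys m)"

definition poly_ring :: "nat \<Rightarrow> 'k::zero mpoly set" where
  "poly_ring n = {p. mpoly_vars p \<subseteq> {..<n}}"

definition homogeneous :: "nat \<Rightarrow> 'k::zero mpoly \<Rightarrow> bool" where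
  "homogeneous d p \<longleftrightarrow> (\<forall>m\<in>Poly_Mapping.keys p. mon_deg m = d)"

definition eval_mpoly :: "'k::comm_semiring_1 mpoly \<Rightarrow> (nat \<Rightarrow> 'k) \<Rightarrow> 'k" where
  "eval_mpoly p x = (\<Sum>m\<in>Poly_Mapping.keys p. Poly_Mapping.lookup p m * (\<Prod>i\<in>Poly_Mapping.keys m. x i ^ Poly_Mapping.lookup m i))"

definition prime_ideal_in :: "nat \<Rightarrow> 'k::comm_ring_1 mpoly set \<Rightarrow> bool" where
  "prime_ideal_in n P \<longleftrightarrow>
     P \<subseteq> poly_ring n \<and> 0 \<in> P \<and> 1 \<notin> P \<and>
     (\<forall>a\<in>P. \<forall>b\<in>P. a + b \<in> P) \<and>
     (\<forall>a\<in>P. \<forall>r\<in>poly_ring n. r * a \<in> P) \<and>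
     (\<forall>a\<in>poly_ring n. \<forall>b\<in>poly_ring n. a * b \<in> P \<longrightarrow> a \<in> P \<or> b \<in> P)"

text \<open>A chain of prime ideals P_0 < P_1 < ... < P_m of length m, all containing S.
  The Krull dimension of k[x_0..x_{n-1}]/I is the supremum of such m for S = I.\<close>
definition prime_chain_over :: "nat \<Rightarrow> 'k::comm_ring_1 mpoly set \<Rightarrow> nat \<Rightarrow> bool" where
  "prime_chain_over n S m \<longleftrightarrow>
     (\<exists>P :: nat \<Rightarrow> 'k mpoly set.
        (\<forall>i\<le>m. prime_ideal_in n (P i) \<and> S \<subseteq> P i) \<and>
        (\<forall>i<m. P i \<subset> P (Suc i)))"

definition kpoints :: "nat \<Rightarrow> 'k::comm_ring_1 mpoly list \<Rightarrow> (nat \<Rightarrow> 'k) set" where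
  "kpoints n fs = {x. (\<forall>i\<ge>n. x i = 0) \<and> (\<forall>f\<in>set fs. eval_mpoly f x = 0)}"

text \<open>Vanishing ideal in k[x_0..x_{n-1}] of a set of k-points; its zero locus
  over the algebraic closure is the Zariski closure of the set.\<close>
definition vanishing_ideal :: "nat \<Rightarrow> (nat \<Rightarrow> 'k::comm_ring_1) set \<Rightarrow> 'k mpoly set" where
  "vanishing_ideal n X = {p\<in>poly_ring n. \<forall>x\<in>X. eval_mpoly p x = 0}"

definition brauer_field :: "'k::field itself \<Rightarrow> bool" where
  "brauer_field _ \<longleftrightarrow>
     (\<forall>d\<ge>1. \<exists>N::nat. \<forall>n>N. \<forall>a::nat \<Rightarrow> 'k.
        \<exists>x::nat \<Rightarrow> 'k. (\<exists>i<n. x i \<noteq> 0) \<and> (\<Sum>i<n. a i * x i ^ d) = 0)"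

end

theory Submission
  imports Defs "HOL-Library.FuncSet"
begin

text \<open>By Brauer's theorem there is a bound \<open>N\<close>, depending only on the degrees and on \<open>k\<close>, such that every
  linear subspace of \<open>k^n\<close> of dimension more than \<open>N\<close> contains a nonzero point of \<open>Z(k)\<close>. If the
  closure of \<open>Z(k)\<close> had dimension less than \<open>n - N - 1\<close>, then, \<open>k\<close> being infinite, \<open>n - N - 1\<close>
  suitable linear forms over \<open>k\<close> would have no common zero on \<open>Z(k)\<close> but the origin, contradicting
  this. Since \<open>Z\<close> has dimension at most \<open>n\<close>, the constant \<open>N + 1\<close> works.\<close>

section \<open>Noetherian subrings and Hilbert's basis theorem\<close>

text \<open>Only the easy half of dimension theory enters. A long chain of primes over the vanishing
  ideal has to be exhibited, and a linear form outside a prime \<open>P\<close> makes every prime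
  over \<open>P\<close> and the form strictly larger than \<open>P\<close>: each cut adds a link,
  with no control on how far the dimension drops. Such a chain reaches full length as soon as its
  last prime is not the ideal of the origin, and the nonzero point of Z(k) on the linear section
  guarantees such a prime. The price is finiteness: a form can be kept outside finitely many primes
  only, hence the basis theorem. The bound n on dim Z comes likewise without height theorems, from
  the algebraic dependence of n + 1 polynomials. The field hypothesis speaks of single diagonal
  equations. Constructing vectors that diagonalize one form of top degree removes it from the
  conditions but creates many forms of lower degree, so their number must stay free in the
  induction. A nonzero form of degree 0 has no zeros, but then no prime contains the system and
  there is no chain to match.\<close>

definition is_subring :: "'a::comm_ring_1 set \<Rightarrow> bool" where
  "is_subring R \<longleftrightarrow> 1 \<in> R \<and> (\<forall>a\<in>R. \<forall>b\<in>R. a - b \<in> R \<and> a * b \<in> R)"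

lemma is_subring_simps:
  assumes "is_subring R"
  shows "1 \<in> R" "0 \<in> R" "a \<in> R \<Longrightarrow> b \<in> R \<Longrightarrow> a - b \<in> R" "a \<in> R \<Longrightarrow> b \<in> R \<Longrightarrow> a * b \<in> R"
    "a \<in> R \<Longrightarrow> - a \<in> R" "a \<in> R \<Longrightarrow> b \<in> R \<Longrightarrow> a + b \<in> R"
proof -
  show 1: "1 \<in> R" and d: "a \<in> R \<Longrightarrow> b \<in> R \<Longrightarrow> a - b \<in> R" for a b
    using assms unfolding is_subring_def by auto
  show "a \<in> R \<Longrightarrow> b \<in> R \<Longrightarrow> a * b \<in> R" using assms unfolding is_subring_def by auto
  show 0: "0 \<in> R" using d[OF 1 1] by simp
  show m: "a \<in> R \<Longrightarrow> - a \<in> R" for a using d[OF 0, of a] by simp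
  show "a \<in> R \<Longrightarrow> b \<in> R \<Longrightarrow> a + b \<in> R" using d[of a "- b"] m by simp
qed

text \<open>Ideals are relative to a carrier set because the rings \<open>poly_ring n\<close> are
  subsets of one type, and the number of variables grows in the induction that proves them
  Noetherian.\<close>

definition ideal_of :: "'a::comm_ring_1 set \<Rightarrow> 'a set \<Rightarrow> bool" where
  "ideal_of R J \<longleftrightarrow> J \<subseteq> R \<and> 0 \<in> J \<and> (\<forall>a\<in>J. \<forall>b\<in>J. a + b \<in> J) \<and> (\<forall>a\<in>J. \<forall>r\<in>R. r * a \<in> J)"

lemma ideal_ofD:
  assumes "ideal_of R J"
  shows "J \<subseteq> R" "0 \<in> J" "a \<in> J \<Longrightarrow> b \<in> J \<Longrightarrow> a + b \<in> J" "a \<in> J \<Longrightarrow> r \<in> R \<Longrightarrow> r * a \<in> J"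
  using assms unfolding ideal_of_def by auto

lemma ideal_of_diff:
  assumes "is_subring R" "ideal_of R J" "a \<in> J" "b \<in> J"
  shows "a - b \<in> J"
proof -
  have "(- 1) * b \<in> J"
    using assms(4) is_subring_simps(5)[OF assms(1) is_subring_simps(1)[OF assms(1)]]
    by (rule ideal_ofD(4)[OF assms(2)])
  from ideal_ofD(3)[OF assms(2,3) this] show ?thesis by simp
qed

text \<open>The ascending chain condition suits both ends: Hilbert's argument tests it on a diagonal
  chain, and Noetherian induction contradicts it by dependent choice.\<close>

definition noetherian_subring :: "'a::comm_ring_1 set \<Rightarrow> bool" where
  "noetherian_subring R \<longleftrightarrow> is_subring R \<and>
     (\<forall>I :: nat \<Rightarrow> 'a set. (\<forall>j. ideal_of R (I j)) \<longrightarrow> (\<forall>j. I j \<subseteq> I (Suc j)) \<longrightarrow> (\<exists>N. \<forall>j\<ge>N. I j = I N))"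

text \<open>\<open>x\<close> may be algebraic over \<open>R\<close>, so the coefficient belongs to a
  representation and not to the element. A zero top coefficient is allowed, which makes the set an
  ideal.\<close>

definition leading_coeffs :: "'a::comm_ring_1 set \<Rightarrow> 'a \<Rightarrow> 'a set \<Rightarrow> nat \<Rightarrow> 'a set" where
  "leading_coeffs R x I d = {c d | c. (\<forall>i. c i \<in> R) \<and> (\<Sum>i\<le>d. c i * x ^ i) \<in> I}"

lemma leading_coeffs_mono: "I \<subseteq> J \<Longrightarrow> leading_coeffs R x I d \<subseteq> leading_coeffs R x J d"
  unfolding leading_coeffs_def by blast

text \<open>Multiplying by \<open>x\<close> shifts a representation by one degree and keeps its top
  coefficient.\<close>

lemma leading_coeffs_Suc:
  assumes R: "is_subring R" and I: "ideal_of R' I" and x: "x \<in> R'"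
  shows "leading_coeffs R x I d \<subseteq> leading_coeffs R x I (Suc d)"
proof
  fix a assume "a \<in> leading_coeffs R x I d"
  then obtain c where c: "a = c d" "\<And>i. c i \<in> R" "(\<Sum>i\<le>d. c i * x ^ i) \<in> I"
    unfolding leading_coeffs_def by auto
  define c' where "c' = case_nat 0 c"
  have "(\<Sum>i\<le>Suc d. c' i * x ^ i) = x * (\<Sum>i\<le>d. c i * x ^ i)"
    by (subst sum.atMost_Suc_shift) (simp add: c'_def sum_distrib_left mult_ac)
  also have "\<dots> \<in> I" by (rule ideal_ofD(4)[OF I c(3) x])
  finally have "(\<Sum>i\<le>Suc d. c' i * x ^ i) \<in> I" .
  moreover have "c' i \<in> R" for i
    unfolding c'_def using c(2) is_subring_simps(2)[OF R] by (cases i) auto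
  moreover have "a = c' (Suc d)" unfolding c'_def c(1) by simp
  ultimately show "a \<in> leading_coeffs R x I (Suc d)" unfolding leading_coeffs_def by blast
qed

lemma ideal_of_leading_coeffs:
  assumes R: "is_subring R" and I: "ideal_of R' I" and "R \<subseteq> R'"
  shows "ideal_of R (leading_coeffs R x I d)"
  unfolding ideal_of_def
proof (intro conjI ballI)
  show "leading_coeffs R x I d \<subseteq> R" unfolding leading_coeffs_def by auto
  show "0 \<in> leading_coeffs R x I d"
    unfolding leading_coeffs_def using is_subring_simps(2)[OF R] ideal_ofD(2)[OF I]
    by (auto intro!: exI[of _ "\<lambda>_. 0"])
next
  fix a b assume "a \<in> leading_coeffs R x I d" "b \<in> leading_coeffs R x I d"
  then obtain c c' where c: "a = c d" "\<And>i. c i \<in> R" "(\<Sum>i\<le>d. c i * x ^ i) \<in> I"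
    and c': "b = c' d" "\<And>i. c' i \<in> R" "(\<Sum>i\<le>d. c' i * x ^ i) \<in> I"
    unfolding leading_coeffs_def by blast
  have "(\<Sum>i\<le>d. (c i + c' i) * x ^ i) \<in> I"
    using ideal_ofD(3)[OF I c(3) c'(3)] by (simp add: distrib_right sum.distrib)
  then show "a + b \<in> leading_coeffs R x I d"
    unfolding leading_coeffs_def using c(1,2) c'(1,2) is_subring_simps(6)[OF R]
    by (auto intro!: exI[of _ "\<lambda>i. c i + c' i"])
next
  fix a r assume "a \<in> leading_coeffs R x I d" and r: "r \<in> R"
  then obtain c where c: "a = c d" "\<And>i. c i \<in> R" "(\<Sum>i\<le>d. c i * x ^ i) \<in> I"
    unfolding leading_coeffs_def by blast
  have "r \<in> R'" using r assms(3) by auto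
  from ideal_ofD(4)[OF I c(3) this] have "(\<Sum>i\<le>d. (r * c i) * x ^ i) \<in> I"
    by (simp add: sum_distrib_left mult_ac)
  then show "r * a \<in> leading_coeffs R x I d"
    unfolding leading_coeffs_def using c(1,2) r is_subring_simps(4)[OF R]
    by (auto intro!: exI[of _ "\<lambda>i. r * c i"])
qed

text \<open>An element of \<open>J\<close> is lowered in degree by subtracting an element of
  \<open>I\<close> with the same formal degree and top coefficient. The difference stays in
  \<open>J\<close>, and induction on the formal degree puts it into \<open>I\<close>.\<close>

lemma ideal_eq_if_leading_coeffs_eq:
  assumes R: "is_subring R" and R': "is_subring R'" and I: "ideal_of R' I" and J: "ideal_of R' J"
    and "I \<subseteq> J" and gen: "\<And>p. p \<in> R' \<Longrightarrow> \<exists>d c. (\<forall>i. c i \<in> R) \<and> p = (\<Sum>i\<le>d. c i * x ^ i)"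
    and eq: "\<And>d. leading_coeffs R x J d \<subseteq> leading_coeffs R x I d"
  shows "I = J"
proof
  have "p \<in> I" if "p \<in> J" "\<And>i. c i \<in> R" "p = (\<Sum>i\<le>d. c i * x ^ i)" for p c d
    using that
  proof (induction d arbitrary: p c)
    case 0
    then have "c 0 \<in> leading_coeffs R x J 0" unfolding leading_coeffs_def by auto
    then have "c 0 \<in> leading_coeffs R x I 0" using eq by blast
    then show ?case using 0 unfolding leading_coeffs_def by auto
  next
    case (Suc d)
    then have "c (Suc d) \<in> leading_coeffs R x J (Suc d)" unfolding leading_coeffs_def by blast
    then have "c (Suc d) \<in> leading_coeffs R x I (Suc d)" using eq by blast
    then obtain c' where c': "c (Suc d) = c' (Suc d)" "\<And>i. c' i \<in> R"
      "(\<Sum>i\<le>Suc d. c' i * x ^ i) \<in> I" unfolding leading_coeffs_def by blast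
    let ?q = "\<Sum>i\<le>Suc d. c' i * x ^ i"
    have "p - ?q \<in> J" using Suc.prems(1) c'(3) \<open>I \<subseteq> J\<close> by (intro ideal_of_diff[OF R' J]) auto
    moreover have "c i - c' i \<in> R" for i using Suc.prems(2) c'(2) is_subring_simps(3)[OF R] by blast
    moreover have "p - ?q = (\<Sum>i\<le>d. (c i - c' i) * x ^ i)"
      unfolding Suc.prems(3) using c'(1) by (simp add: left_diff_distrib sum_subtractf)
    ultimately have "p - ?q \<in> I" by (rule Suc.IH[of "p - ?q" "\<lambda>i. c i - c' i"])
    from ideal_ofD(3)[OF I this c'(3)] show ?case by simp
  qed
  then show "J \<subseteq> I" using gen ideal_ofD(1)[OF J] by blast
qed (rule \<open>I \<subseteq> J\<close>)

text \<open>The leading coefficient ideals increase both with the degree and along the chain. Their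
  diagonal becomes constant at some \<open>N1\<close>, which settles all degrees from
  \<open>N1\<close> on at once; the finitely many lower degrees are stabilised one by one.\<close>

lemma hilbert_basis:
  assumes noeth: "noetherian_subring R" and R': "is_subring R'" and "R \<subseteq> R'" and x: "x \<in> R'"
    and gen: "\<And>p. p \<in> R' \<Longrightarrow> \<exists>d c. (\<forall>i. c i \<in> R) \<and> p = (\<Sum>i\<le>d. c i * x ^ i)"
  shows "noetherian_subring R'"
  unfolding noetherian_subring_def
proof (intro conjI allI impI)
  show "is_subring R'" by (rule R')
  have R: "is_subring R" using noeth unfolding noetherian_subring_def by blast
  fix I :: "nat \<Rightarrow> 'a set" assume I: "\<forall>j. ideal_of R' (I j)" and inc: "\<forall>j. I j \<subseteq> I (Suc j)"
  have I_mono: "I i \<subseteq> I j" if "i \<le> j" for i j using lift_Suc_mono_le[of I] inc that by blast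
  define L where "L d j = leading_coeffs R x (I j) d" for d j
  have L_ideal: "ideal_of R (L d j)" for d j
    unfolding L_def using ideal_of_leading_coeffs[OF R _ \<open>R \<subseteq> R'\<close>] I by blast
  have L_mono: "L d i \<subseteq> L e j" if "d \<le> e" "i \<le> j" for d e i j
  proof -
    have "L d i \<subseteq> L d j" unfolding L_def by (rule leading_coeffs_mono[OF I_mono[OF that(2)]])
    also have "L d j \<subseteq> L e j"
      using lift_Suc_mono_le[of "\<lambda>d. L d j"] leading_coeffs_Suc[OF R _ x] I that(1)
      unfolding L_def by blast
    finally show ?thesis .
  qed
  have stab: "\<exists>N. \<forall>j\<ge>N. K j = K N" if "\<And>j. ideal_of R (K j)" "\<And>j. K j \<subseteq> K (Suc j)" for K :: "nat \<Rightarrow> 'a set"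
    using noeth that unfolding noetherian_subring_def by blast
  obtain N1 where N1: "\<And>j. j \<ge> N1 \<Longrightarrow> L j j = L N1 N1"
    using stab[of "\<lambda>j. L j j"] L_ideal L_mono by (metis le_SucI order_refl)
  have "\<forall>d. \<exists>M. \<forall>j\<ge>M. L d j = L d M"
    using stab[of "L _"] L_ideal L_mono by (metis le_SucI order_refl)
  then obtain M where M: "\<And>d j. j \<ge> M d \<Longrightarrow> L d j = L d (M d)" by metis
  define N where "N = Max (insert N1 (M ` {..<N1}))"
  have N: "N1 \<le> N" "\<And>d. d < N1 \<Longrightarrow> M d \<le> N" unfolding N_def by auto
  show "\<exists>N. \<forall>j\<ge>N. I j = I N"
  proof (intro exI[of _ N] allI impI)
    fix j assume j: "N \<le> j"
    have "L d j \<subseteq> L d N" for d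
    proof (cases "d < N1")
      case True
      then show ?thesis using M[of d j] M[of d N] N(2)[of d] j by auto
    next
      case False
      \<comment> \<open>Going up to the diagonal reaches its constant value \<open>L N1 N1\<close>,
        which lies in \<open>L d N\<close> because \<open>d\<close> and \<open>N\<close> are both at
        least \<open>N1\<close>.\<close>
      have "L d j \<subseteq> L (max d j) (max d j)" by (rule L_mono) auto
      also have "\<dots> = L N1 N1" using False by (intro N1) auto
      also have "\<dots> \<subseteq> L d N" using False N(1) by (intro L_mono) auto
      finally show ?thesis .
    qed
    then show "I j = I N"
      using ideal_eq_if_leading_coeffs_eq[OF R R' _ _ I_mono[OF j] gen] I unfolding L_def by metis
  qed
qed

text \<open>The induction runs from larger ideals to smaller ones: every counterexample has a
  strictly larger one above it, and dependent choice strings these into a chain that never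
  stabilises.\<close>

lemma noetherian_induct:
  assumes noeth: "noetherian_subring R" and J: "ideal_of R J"
    and step: "\<And>J. ideal_of R J \<Longrightarrow> (\<And>K. ideal_of R K \<Longrightarrow> J \<subset> K \<Longrightarrow> P K) \<Longrightarrow> P J"
  shows "P J"
proof (rule ccontr)
  assume "\<not> P J"
  have ex: "\<exists>K. ideal_of R K \<and> \<not> P K \<and> J \<subset> K" if "ideal_of R J \<and> \<not> P J" for J using step that by blast
  obtain I where I: "\<And>j::nat. ideal_of R (I j) \<and> \<not> P (I j)" "\<And>j. I j \<subset> I (Suc j)"
    using dependent_nat_choice[of "\<lambda>_ K. ideal_of R K \<and> \<not> P K" "\<lambda>_ K K'. K \<subset> K'"] J \<open>\<not> P J\<close> ex
    by metis
  then show False using noeth unfolding noetherian_subring_def by (metis less_le le_SucI order_refl psubset_imp_subset order_less_irrefl)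
qed

section \<open>Brauer's theorem on systems of forms\<close>

text \<open>A form of degree \<open>card E\<close> is encoded as \<open>v \<mapsto> T (\<lambda>_. v)\<close> with \<open>T\<close> multilinear in the slots
  \<open>E\<close>; this works in every characteristic. Arbitrary slot sets are allowed so that filling some of
  the slots with fixed vectors again gives a form, of lower degree, in the remaining ones.\<close>

definition multilinear_on :: "nat set \<Rightarrow> ((nat \<Rightarrow> nat \<Rightarrow> 'k::field) \<Rightarrow> 'k) \<Rightarrow> bool" where
  "multilinear_on E T \<longleftrightarrow>
     (\<forall>u u'. (\<forall>l\<in>E. u l = u' l) \<longrightarrow> T u = T u') \<and>
     (\<forall>l\<in>E. \<forall>u a b s t.
        T (u(l := (\<lambda>i. s * a i + t * b i))) = s * T (u(l := a)) + t * T (u(l := b)))"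

lemma multilinear_on_cong:
  "multilinear_on E T \<Longrightarrow> (\<And>l. l \<in> E \<Longrightarrow> u l = u' l) \<Longrightarrow> T u = T u'"
  unfolding multilinear_on_def by blast

lemma multilinear_on_slot:
  "multilinear_on E T \<Longrightarrow> l \<in> E \<Longrightarrow>
     T (u(l := (\<lambda>i. s * a i + t * b i))) = s * T (u(l := a)) + t * T (u(l := b))"
  unfolding multilinear_on_def by blast

lemma multilinear_on_slot_sum:
  assumes T: "multilinear_on E T" and l: "l \<in> E" and "finite I"
  shows "T (u(l := (\<lambda>i. \<Sum>j\<in>I. t j * w j i))) = (\<Sum>j\<in>I. t j * T (u(l := w j)))"
  using \<open>finite I\<close>
proof (induction I)
  case empty
  \<comment> \<open>Both scalars are 0: a zero vector in a slot kills the value.\<close>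
  show ?case using multilinear_on_slot[OF T l, of u 0 "\<lambda>_. 0" 0 "\<lambda>_. 0"]
    by (simp del: fun_upd_apply)
next
  case (insert x I)
  show ?case
    using multilinear_on_slot[OF T l, of u "t x" "w x" 1 "\<lambda>i. \<Sum>j\<in>I. t j * w j i"] insert
    by (simp del: fun_upd_apply)
qed

text \<open>The expansion of a product of sums, with one choice function \<open>\<phi>\<close> per
  term. Slots outside \<open>F\<close> hold an arbitrary \<open>u\<close>, since the induction over
  \<open>F\<close> stores the slot not yet expanded in \<open>u\<close>.\<close>

lemma multilinear_on_expand:
  assumes T: "multilinear_on E T" and "finite F" and "F \<subseteq> E" and I: "finite I"
  shows "T (\<lambda>l. if l \<in> F then (\<lambda>i. \<Sum>j\<in>I. t j * w j i) else u l) =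
     (\<Sum>\<phi>\<in>F \<rightarrow>\<^sub>E I. (\<Prod>l\<in>F. t (\<phi> l)) * T (\<lambda>l. if l \<in> F then w (\<phi> l) else u l))"
  using assms(2,3)
proof (induction F arbitrary: u)
  case empty
  show ?case by simp
next
  case (insert x F)
  let ?S = "\<lambda>i. \<Sum>j\<in>I. t j * w j i"
  have x: "x \<in> E" using insert by auto
  have "(\<lambda>l. if l \<in> insert x F then ?S else u l) = (\<lambda>l. if l \<in> F then ?S else (u(x := ?S)) l)"
    by auto
  then have "T (\<lambda>l. if l \<in> insert x F then ?S else u l) =
     (\<Sum>\<phi>\<in>F \<rightarrow>\<^sub>E I. (\<Prod>l\<in>F. t (\<phi> l)) * T (\<lambda>l. if l \<in> F then w (\<phi> l) else (u(x := ?S)) l))"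
    using insert by simp
  also have "\<dots> = (\<Sum>\<phi>\<in>F \<rightarrow>\<^sub>E I. \<Sum>j\<in>I. (\<Prod>l\<in>F. t (\<phi> l)) *
       (t j * T ((\<lambda>l. if l \<in> F then w (\<phi> l) else u l)(x := w j))))"
  proof (rule sum.cong[OF refl])
    fix \<phi>
    have "(\<lambda>l. if l \<in> F then w (\<phi> l) else (u(x := ?S)) l) =
        (\<lambda>l. if l \<in> F then w (\<phi> l) else u l)(x := ?S)"
      using insert(2) by auto
    then show "(\<Prod>l\<in>F. t (\<phi> l)) * T (\<lambda>l. if l \<in> F then w (\<phi> l) else (u(x := ?S)) l) =
       (\<Sum>j\<in>I. (\<Prod>l\<in>F. t (\<phi> l)) * (t j * T ((\<lambda>l. if l \<in> F then w (\<phi> l) else u l)(x := w j))))"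
      by (simp only: multilinear_on_slot_sum[OF T x I] sum_distrib_left)
  qed
  also have "\<dots> = (\<Sum>(j,\<phi>)\<in>I \<times> (F \<rightarrow>\<^sub>E I). (\<Prod>l\<in>F. t (\<phi> l)) *
       (t j * T ((\<lambda>l. if l \<in> F then w (\<phi> l) else u l)(x := w j))))"
    by (subst sum.swap) (simp add: sum.cartesian_product)
  also have "\<dots> = (\<Sum>\<psi>\<in>insert x F \<rightarrow>\<^sub>E I.
      (\<Prod>l\<in>insert x F. t (\<psi> l)) * T (\<lambda>l. if l \<in> insert x F then w (\<psi> l) else u l))"
    unfolding PiE_insert_eq
  proof (subst sum.reindex)
    show "inj_on (\<lambda>(y, g). g(x := y)) (I \<times> (F \<rightarrow>\<^sub>E I))"
      using inj_combinator[OF insert(2), of "\<lambda>_. I"] by simp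
    show "(\<Sum>(j,\<phi>)\<in>I \<times> (F \<rightarrow>\<^sub>E I). (\<Prod>l\<in>F. t (\<phi> l)) *
       (t j * T ((\<lambda>l. if l \<in> F then w (\<phi> l) else u l)(x := w j)))) =
      sum ((\<lambda>\<psi>. (\<Prod>l\<in>insert x F. t (\<psi> l)) * T (\<lambda>l. if l \<in> insert x F then w (\<psi> l) else u l))
        \<circ> (\<lambda>(y, g). g(x := y))) (I \<times> (F \<rightarrow>\<^sub>E I))"
    proof (rule sum.cong[OF refl], clarify)
      fix j \<phi>
      have 1: "(\<Prod>l\<in>insert x F. t ((\<phi>(x := j)) l)) = t j * (\<Prod>l\<in>F. t (\<phi> l))"
      proof -
        have "(\<Prod>l\<in>F. t ((\<phi>(x := j)) l)) = (\<Prod>l\<in>F. t (\<phi> l))"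
          by (rule prod.cong) (use insert(2) in auto)
        then show ?thesis using insert(1,2) by simp
      qed
      have 2: "(\<lambda>l. if l \<in> insert x F then w ((\<phi>(x := j)) l) else u l) =
          (\<lambda>l. if l \<in> F then w (\<phi> l) else u l)(x := w j)"
        using insert(2) by auto
      show "(\<Prod>l\<in>F. t (\<phi> l)) * (t j * T ((\<lambda>l. if l \<in> F then w (\<phi> l) else u l)(x := w j))) =
       ((\<lambda>\<psi>. (\<Prod>l\<in>insert x F. t (\<psi> l)) * T (\<lambda>l. if l \<in> insert x F then w (\<psi> l) else u l))
        \<circ> (\<lambda>(y, g). g(x := y))) (j, \<phi>)"
        unfolding comp_def split 1 2 by (simp add: mult_ac)
    qed
  qed
  finally show ?case .
qed

lemma multilinear_on_sum:
  assumes T: "multilinear_on E T" and E: "finite E" and I: "finite I"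
  shows "T (\<lambda>_. (\<lambda>i. \<Sum>j\<in>I. t j * w j i)) =
     (\<Sum>\<phi>\<in>E \<rightarrow>\<^sub>E I. (\<Prod>l\<in>E. t (\<phi> l)) * T (\<lambda>l. w (\<phi> l)))"
proof -
  let ?S = "\<lambda>i. \<Sum>j\<in>I. t j * w j i"
  have "T (\<lambda>_. ?S) = T (\<lambda>l. if l \<in> E then ?S else ?S)" by simp
  also have "\<dots> = (\<Sum>\<phi>\<in>E \<rightarrow>\<^sub>E I. (\<Prod>l\<in>E. t (\<phi> l)) * T (\<lambda>l. if l \<in> E then w (\<phi> l) else ?S))"
    by (rule multilinear_on_expand[OF T E subset_refl I])
  also have "\<dots> = (\<Sum>\<phi>\<in>E \<rightarrow>\<^sub>E I. (\<Prod>l\<in>E. t (\<phi> l)) * T (\<lambda>l. w (\<phi> l)))"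
    by (intro sum.cong refl arg_cong2[of _ _ _ _ "(*)"] multilinear_on_cong[OF T]) auto
  finally show ?thesis .
qed

text \<open>Freezing the slots with \<open>\<phi> l \<noteq> j\<close> at
  \<open>v (\<phi> l)\<close> leaves a form in the others. With \<open>v\<close> the vectors already
  found, these forms are the conditions on the vector with index \<open>j\<close>.\<close>

lemma multilinear_on_restrict:
  assumes T: "multilinear_on E T"
  shows "multilinear_on {l\<in>E. \<phi> l = j} (\<lambda>u. T (\<lambda>l. if \<phi> l = j then u l else v (\<phi> l)))"
  unfolding multilinear_on_def
proof (intro conjI allI impI ballI)
  fix u u' :: "nat \<Rightarrow> nat \<Rightarrow> 'a" assume "\<forall>l\<in>{l\<in>E. \<phi> l = j}. u l = u' l"
  then show "T (\<lambda>l. if \<phi> l = j then u l else v (\<phi> l)) = T (\<lambda>l. if \<phi> l = j then u' l else v (\<phi> l))"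
    by (intro multilinear_on_cong[OF T]) auto
next
  fix l u a b s t assume l: "l \<in> {l\<in>E. \<phi> l = j}"
  have "(\<lambda>l'. if \<phi> l' = j then (u(l := c)) l' else v (\<phi> l')) =
      (\<lambda>l'. if \<phi> l' = j then u l' else v (\<phi> l'))(l := c)" for c
    using l by auto
  then show "T (\<lambda>l'. if \<phi> l' = j then (u(l := (\<lambda>i. s * a i + t * b i))) l' else v (\<phi> l')) =
     s * T (\<lambda>l'. if \<phi> l' = j then (u(l := a)) l' else v (\<phi> l')) +
     t * T (\<lambda>l'. if \<phi> l' = j then (u(l := b)) l' else v (\<phi> l'))"
    using l by (simp only:) (simp add: multilinear_on_slot[OF T])
qed

section \<open>Brauer's induction on degrees and numbers of forms\<close>

lemma disjoint_blocks:
  assumes "finite B" and "m * b \<le> card B"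
  obtains D :: "nat \<Rightarrow> 'a set" where "\<And>j. j < m \<Longrightarrow> D j \<subseteq> B \<and> finite (D j) \<and> card (D j) = b"
    and "\<And>i j. i < m \<Longrightarrow> j < m \<Longrightarrow> i \<noteq> j \<Longrightarrow> D i \<inter> D j = {}"
proof -
  obtain h where h: "bij_betw h {0..<card B} B" using ex_bij_betw_nat_finite[OF assms(1)] by auto
  define K where "K j = {j * b..<Suc j * b}" for j
  have K: "K j \<subseteq> {0..<card B}" if "j < m" for j
  proof -
    have "Suc j * b \<le> m * b" using that by (intro mult_le_mono1) simp
    then show ?thesis using assms(2) unfolding K_def by auto
  qed
  have inj: "inj_on h {0..<card B}" using h by (rule bij_betw_imp_inj_on)
  have disj: "K i \<inter> K j = {}" if "i < j" for i j
  proof -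
    have "Suc i * b \<le> j * b" using that by (intro mult_le_mono1) simp
    then show ?thesis unfolding K_def by auto
  qed
  show ?thesis
  proof
    show "h ` K j \<subseteq> B \<and> finite (h ` K j) \<and> card (h ` K j) = b" if "j < m" for j
      using K[OF that] h inj card_image[OF inj_on_subset[OF inj K[OF that]]]
      by (auto simp: bij_betw_def K_def)
    show "h ` K i \<inter> h ` K j = {}" if "i < m" "j < m" "i \<noteq> j" for i j
    proof -
      have "K i \<inter> K j = {}" using disj[of i j] disj[of j i] that by (cases "i < j") auto
      then show ?thesis using inj_on_image_Int[OF inj K[OF that(1)] K[OF that(2)]] by auto
    qed
  qed
qed

type_synonym 'k form_system = "(nat set \<times> ((nat \<Rightarrow> nat \<Rightarrow> 'k) \<Rightarrow> 'k)) set"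

text \<open>Bookkeeping for a double induction: \<open>d\<close> bounds the degrees,
  \<open>r\<close> the number of forms of degree exactly \<open>d\<close>, and \<open>q\<close> the
  number of all forms. One step lowers \<open>r\<close> at the cost of multiplying \<open>q\<close>.
  Slot sets are nonempty since a nonzero constant has no zeros.\<close>

definition forms_upto :: "nat \<Rightarrow> nat \<Rightarrow> nat \<Rightarrow> 'k::field form_system \<Rightarrow> bool" where
  "forms_upto d r q S \<longleftrightarrow> finite S \<and> card S \<le> q \<and> card {s\<in>S. card (fst s) = d} \<le> r \<and>
     (\<forall>s\<in>S. finite (fst s) \<and> fst s \<noteq> {} \<and> card (fst s) \<le> d \<and> multilinear_on (fst s) (snd s))"

text \<open>The coordinate set \<open>B\<close> is arbitrary, so that one bound serves on disjoint
  blocks of coordinates and on the free coordinates of a linear subspace.\<close>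

definition solvable_beyond :: "nat \<Rightarrow> 'k::field form_system \<Rightarrow> bool" where
  "solvable_beyond N S \<longleftrightarrow> (\<forall>B. finite B \<longrightarrow> N < card B \<longrightarrow>
     (\<exists>v. (\<forall>i. i \<notin> B \<longrightarrow> v i = 0) \<and> (\<exists>i. v i \<noteq> 0) \<and> (\<forall>s\<in>S. snd s (\<lambda>_. v) = 0)))"

text \<open>On the span of the vectors \<open>v i\<close> all forms of \<open>S\<close> vanish except for \<open>s0\<close>, which becomes
  diagonal. The conditions on the next vector are forms in it, and only the forms of \<open>S\<close> other than
  \<open>s0\<close> contribute conditions of degree \<open>d\<close>.\<close>

lemma diagonalizing_vectors:
  fixes S :: "'k::field form_system"
  assumes S: "forms_upto d (Suc r) q S"
    and s0: "s0 \<in> S" "card (fst s0) = d"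
    and IH: "\<And>S' :: 'k form_system. forms_upto d r (q * m ^ d) S' \<Longrightarrow> solvable_beyond N S'"
    and D: "\<And>j. j < m \<Longrightarrow> finite (D j) \<and> N < card (D j)"
    and "j \<le> m"
  shows "\<exists>v. \<forall>i<j. (\<forall>x. x \<notin> D i \<longrightarrow> v i x = 0) \<and> (\<exists>x. v i x \<noteq> 0) \<and>
     (\<forall>s\<in>S. \<forall>\<phi>\<in>fst s \<rightarrow>\<^sub>E {..i}. i \<in> \<phi> ` fst s \<longrightarrow> \<not> (s = s0 \<and> \<phi> ` fst s = {i}) \<longrightarrow>
        snd s (\<lambda>l. v (\<phi> l)) = 0)"
  using \<open>j \<le> m\<close>
proof (induction j)
  case 0
  show ?case by simp
next
  case (Suc j)
  from Suc.IH[OF Suc_leD[OF Suc.prems]] obtain v where v': "\<forall>i<j. (\<forall>x. x \<notin> D i \<longrightarrow> v i x = 0) \<and> (\<exists>x. v i x \<noteq> 0) \<and>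
     (\<forall>s\<in>S. \<forall>\<phi>\<in>fst s \<rightarrow>\<^sub>E {..i}. i \<in> \<phi> ` fst s \<longrightarrow> \<not> (s = s0 \<and> \<phi> ` fst s = {i}) \<longrightarrow>
        snd s (\<lambda>l. v (\<phi> l)) = 0)"
    by (elim exE)
  note v = v'[THEN spec, THEN mp]
  have fin: "finite S" and cS: "card S \<le> q" and cd: "card {s\<in>S. card (fst s) = d} \<le> Suc r"
    and sS: "\<And>s. s \<in> S \<Longrightarrow> finite (fst s) \<and> fst s \<noteq> {} \<and> card (fst s) \<le> d \<and> multilinear_on (fst s) (snd s)"
    using S unfolding forms_upto_def by auto
  \<comment> \<open>The term of \<open>s\<close> indexed by \<open>\<phi>\<close>, seen as a form in
    the vector at \<open>j\<close>; its degree is the number of slots that \<open>\<phi>\<close>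
    sends to \<open>j\<close>.\<close>
  define G where "G = (\<lambda>(s :: nat set \<times> ((nat \<Rightarrow> nat \<Rightarrow> 'k) \<Rightarrow> 'k), \<phi>). ({l\<in>fst s. \<phi> l = j},
      \<lambda>u. snd s (\<lambda>l. if \<phi> l = j then u l else v (\<phi> l))))"
  \<comment> \<open>Only terms with largest index \<open>j\<close> are new; the others were treated
    when their own largest index was reached. The pair left out is the diagonal term of
    \<open>s0\<close>, which becomes a coefficient of the diagonal form.\<close>
  define K where "K = {(s,\<phi>) \<in> Sigma S (\<lambda>s. fst s \<rightarrow>\<^sub>E {..j}).
      j \<in> \<phi> ` fst s \<and> \<not> (s = s0 \<and> \<phi> ` fst s = {j})}"
  have finSig: "finite (Sigma S (\<lambda>s. fst s \<rightarrow>\<^sub>E {..j}))"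
    using fin sS by (intro finite_SigmaI finite_PiE) auto
  have Ksub: "K \<subseteq> Sigma S (\<lambda>s. fst s \<rightarrow>\<^sub>E {..j})" unfolding K_def by auto
  have finK: "finite K" using finite_subset[OF Ksub finSig] .
  have "card K \<le> card (Sigma S (\<lambda>s. fst s \<rightarrow>\<^sub>E {..j}))" by (rule card_mono[OF finSig Ksub])
  also have "\<dots> = (\<Sum>s\<in>S. card (fst s \<rightarrow>\<^sub>E {..j}))"
    using fin sS by (intro card_SigmaI) (auto intro!: finite_PiE)
  also have "\<dots> \<le> (\<Sum>s\<in>S. m ^ d)"
  proof (rule sum_mono)
    fix s assume s: "s \<in> S"
    have "card (fst s \<rightarrow>\<^sub>E {..j}) = Suc j ^ card (fst s)"
      using sS[OF s] by (subst card_PiE) auto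
    also have "\<dots> \<le> m ^ card (fst s)" using Suc.prems by (intro power_mono) auto
    also have "\<dots> \<le> m ^ d" using Suc.prems sS[OF s] by (intro power_increasing) auto
    finally show "card (fst s \<rightarrow>\<^sub>E {..j}) \<le> m ^ d" .
  qed
  also have "\<dots> \<le> q * m ^ d" using cS by simp
  finally have cK: "card K \<le> q * m ^ d" .
  have "forms_upto d r (q * m ^ d) (G ` K)"
    unfolding forms_upto_def
  proof (intro conjI ballI)
    show "finite (G ` K)" using finK by simp
    show "card (G ` K) \<le> q * m ^ d" using card_image_le[OF finK, of G] cK by simp
    let ?H = "{s\<in>S. card (fst s) = d} - {s0}"
    \<comment> \<open>Degree \<open>d\<close> is reached only if \<open>\<phi>\<close> is constantly
      \<open>j\<close> on a form of degree \<open>d\<close>, and for \<open>s0\<close> this term is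
      excluded. This is where \<open>Suc r\<close> drops to \<open>r\<close>.\<close>
    have "{s\<in>G ` K. card (fst s) = d} \<subseteq> (\<lambda>s. G (s, \<lambda>l\<in>fst s. j)) ` ?H"
    proof
      fix t assume "t \<in> {s\<in>G ` K. card (fst s) = d}"
      then obtain s \<phi> where t: "t = G (s, \<phi>)" "(s, \<phi>) \<in> K" "card (fst t) = d" by auto
      have s: "s \<in> S" and \<phi>: "\<phi> \<in> fst s \<rightarrow>\<^sub>E {..j}" "\<not> (s = s0 \<and> \<phi> ` fst s = {j})"
        "j \<in> \<phi> ` fst s" using t(2) unfolding K_def by auto
      have c: "card {l\<in>fst s. \<phi> l = j} = d" using t(1,3) unfolding G_def by simp
      have "{l\<in>fst s. \<phi> l = j} = fst s"
        using sS[OF s] c by (intro card_seteq) auto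
      then have all: "\<And>l. l \<in> fst s \<Longrightarrow> \<phi> l = j" by blast
      have "\<phi> = (\<lambda>l\<in>fst s. j)"
        using \<phi>(1) all by (intro ext) (auto simp: PiE_def extensional_def)
      moreover have "card (fst s) = d" using c \<open>{l\<in>fst s. \<phi> l = j} = fst s\<close> by simp
      moreover have "s \<noteq> s0" using \<phi>(2,3) all by auto
      ultimately show "t \<in> (\<lambda>s. G (s, \<lambda>l\<in>fst s. j)) ` ?H" using t(1) s by auto
    qed
    then have "card {s\<in>G ` K. card (fst s) = d} \<le> card ((\<lambda>s. G (s, \<lambda>l\<in>fst s. j)) ` ?H)"
      using fin by (intro card_mono) auto
    also have "\<dots> \<le> card ?H" using fin by (intro card_image_le) auto
    also have "\<dots> \<le> r" using cd s0 fin by (subst card_Diff_singleton) auto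
    finally show "card {s\<in>G ` K. card (fst s) = d} \<le> r" .
  next
    fix t assume "t \<in> G ` K"
    then obtain s \<phi> where t: "t = G (s, \<phi>)" "(s, \<phi>) \<in> K" by auto
    have s: "s \<in> S" and \<phi>: "j \<in> \<phi> ` fst s" using t(2) unfolding K_def by auto
    show "finite (fst t)" using t(1) sS[OF s] unfolding G_def by simp
    show "fst t \<noteq> {}" using t(1) \<phi> unfolding G_def by auto
    have "card {l\<in>fst s. \<phi> l = j} \<le> card (fst s)" using sS[OF s] by (intro card_mono) auto
    then show "card (fst t) \<le> d" using t(1) sS[OF s] unfolding G_def by simp
    show "multilinear_on (fst t) (snd t)"
      using multilinear_on_restrict[of "fst s" "snd s"] sS[OF s] unfolding t(1) G_def by simp
  qed
  from IH[OF this] D[of j] Suc.prems obtain y where y: "\<And>i. i \<notin> D j \<Longrightarrow> y i = 0" "\<exists>i. y i \<noteq> 0"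
      "\<And>s. s \<in> G ` K \<Longrightarrow> snd s (\<lambda>_. y) = 0"
    unfolding solvable_beyond_def by (metis Suc_le_lessD)
  show ?case
  proof (intro exI[of _ "v(j := y)"] allI impI)
    fix i assume "i < Suc j"
    then consider "i < j" | "i = j" by linarith
    then show "(\<forall>x. x \<notin> D i \<longrightarrow> (v(j := y)) i x = 0) \<and> (\<exists>x. (v(j := y)) i x \<noteq> 0) \<and>
     (\<forall>s\<in>S. \<forall>\<phi>\<in>fst s \<rightarrow>\<^sub>E {..i}. i \<in> \<phi> ` fst s \<longrightarrow> \<not> (s = s0 \<and> \<phi> ` fst s = {i}) \<longrightarrow>
        snd s (\<lambda>l. (v(j := y)) (\<phi> l)) = 0)"
    proof cases
      case 1
      \<comment> \<open>Conditions at an earlier index \<open>i\<close> involve only vectors up to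
        \<open>i\<close>, so placing \<open>y\<close> at \<open>j\<close> does not disturb
        them.\<close>
      have "snd s (\<lambda>l. (v(j := y)) (\<phi> l)) = 0"
        if "s \<in> S" "\<phi> \<in> fst s \<rightarrow>\<^sub>E {..i}" "i \<in> \<phi> ` fst s" "\<not> (s = s0 \<and> \<phi> ` fst s = {i})" for s \<phi>
      proof -
        have "snd s (\<lambda>l. (v(j := y)) (\<phi> l)) = snd s (\<lambda>l. v (\<phi> l))"
        proof (rule multilinear_on_cong[of "fst s" "snd s"])
          show "multilinear_on (fst s) (snd s)" using sS[OF that(1)] by blast
          show "(v(j := y)) (\<phi> l) = v (\<phi> l)" if "l \<in> fst s" for l
            using PiE_mem[OF \<open>\<phi> \<in> _\<close> that] 1 by simp
        qed
        then show ?thesis using v[OF 1] that by metis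
      qed
      then show ?thesis using v[OF 1] 1 by simp
    next
      case 2
      have "snd s (\<lambda>l. (v(j := y)) (\<phi> l)) = 0"
        if "s \<in> S" "\<phi> \<in> fst s \<rightarrow>\<^sub>E {..j}" "j \<in> \<phi> ` fst s" "\<not> (s = s0 \<and> \<phi> ` fst s = {j})" for s \<phi>
      proof -
        have "(s, \<phi>) \<in> K" using that unfolding K_def by auto
        then have "snd (G (s, \<phi>)) (\<lambda>_. y) = 0" using y(3) by blast
        moreover have "(\<lambda>l. (v(j := y)) (\<phi> l)) = (\<lambda>l. if \<phi> l = j then y else v (\<phi> l))" by auto
        ultimately show ?thesis unfolding G_def by simp
      qed
      then show ?thesis using y(1,2) 2 by simp
    qed
  qed
qed

text \<open>On the span of \<open>m = N0 + 1\<close> diagonalizing vectors one form of degree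
  \<open>d\<close> becomes diagonal in the \<open>m\<close> coefficients and all the others vanish,
  so the hypothesis on a single diagonal equation gives a nonzero combination.\<close>

lemma solvable_step:
  fixes d r :: nat
  assumes brauer: "\<forall>n>N0. \<forall>a::nat \<Rightarrow> 'k::field. \<exists>x::nat \<Rightarrow> 'k. (\<exists>i<n. x i \<noteq> 0) \<and> (\<Sum>i<n. a i * x i ^ d) = 0"
    and IH: "\<And>q. \<exists>N. \<forall>S :: 'k form_system. forms_upto d r q S \<longrightarrow> solvable_beyond N S"
  shows "\<exists>N. \<forall>S :: 'k form_system. forms_upto d (Suc r) q S \<longrightarrow> solvable_beyond N S"
proof -
  define m where "m = Suc N0"
  obtain N1 where N1: "\<And>S :: 'k form_system. forms_upto d r q S \<Longrightarrow> solvable_beyond N1 S"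
    using IH by blast
  obtain N where N: "\<And>S :: 'k form_system. forms_upto d r (q * m ^ d) S \<Longrightarrow> solvable_beyond N S"
    using IH by blast
  \<comment> \<open>\<open>N1\<close> serves the systems without a form of degree \<open>d\<close>;
    \<open>m * Suc N\<close> leaves room for \<open>m\<close> blocks, each with more than
    \<open>N\<close> coordinates.\<close>
  have "solvable_beyond (max N1 (m * Suc N)) S" if S: "forms_upto d (Suc r) q S" for S :: "'k form_system"
    unfolding solvable_beyond_def
  proof (intro allI impI)
    fix B :: "nat set" assume B: "finite B" "max N1 (m * Suc N) < card B"
    have fin: "finite S" and sS: "\<And>s. s \<in> S \<Longrightarrow> finite (fst s) \<and> fst s \<noteq> {} \<and> multilinear_on (fst s) (snd s)"
      using S unfolding forms_upto_def by auto
    show "\<exists>v. (\<forall>i. i \<notin> B \<longrightarrow> v i = 0) \<and> (\<exists>i. v i \<noteq> 0) \<and> (\<forall>s\<in>S. snd s (\<lambda>_. v) = 0)"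
    proof (cases "{s\<in>S. card (fst s) = d} = {}")
      case True
      then have "card {s\<in>S. card (fst s) = d} = 0" by (simp only: card.empty)
      then have "forms_upto d r q S" using S unfolding forms_upto_def by (metis zero_le)
      then show ?thesis using N1 B unfolding solvable_beyond_def by simp
    next
      case False
      then obtain s0 where s0: "s0 \<in> S" "card (fst s0) = d" by auto
      \<comment> \<open>Vectors with disjoint supports are linearly independent, so a nontrivial
        combination of them cannot vanish.\<close>
      obtain D where D: "\<And>j. j < m \<Longrightarrow> D j \<subseteq> B \<and> finite (D j) \<and> card (D j) = Suc N"
        and disj: "\<And>i j. i < m \<Longrightarrow> j < m \<Longrightarrow> i \<noteq> j \<Longrightarrow> D i \<inter> D j = {}"
        using disjoint_blocks[of B m "Suc N"] B by auto
      have Dm: "finite (D j) \<and> N < card (D j)" if "j < m" for j using D[OF that] by simp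
      have "\<exists>v. \<forall>i<m. (\<forall>x. x \<notin> D i \<longrightarrow> v i x = 0) \<and> (\<exists>x. v i x \<noteq> 0) \<and>
         (\<forall>s\<in>S. \<forall>\<phi>\<in>fst s \<rightarrow>\<^sub>E {..i}. i \<in> \<phi> ` fst s \<longrightarrow> \<not> (s = s0 \<and> \<phi> ` fst s = {i}) \<longrightarrow>
            snd s (\<lambda>l. v (\<phi> l)) = 0)"
        by (rule diagonalizing_vectors[OF S s0 _ _ order_refl]) (fact N, fact Dm)
      then obtain v where v': "\<forall>i<m. (\<forall>x. x \<notin> D i \<longrightarrow> v i x = 0) \<and> (\<exists>x. v i x \<noteq> 0) \<and>
         (\<forall>s\<in>S. \<forall>\<phi>\<in>fst s \<rightarrow>\<^sub>E {..i}. i \<in> \<phi> ` fst s \<longrightarrow> \<not> (s = s0 \<and> \<phi> ` fst s = {i}) \<longrightarrow>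
            snd s (\<lambda>l. v (\<phi> l)) = 0)" by (elim exE)
      note v = v'[THEN spec, THEN mp]
      have "\<exists>x. (\<exists>i<m. x i \<noteq> 0) \<and> (\<Sum>i<m. snd s0 (\<lambda>_. v i) * x i ^ d) = 0"
        using brauer[rule_format, of m "\<lambda>i. snd s0 (\<lambda>_. v i)"] unfolding m_def by simp
      then obtain t where t: "\<exists>i<m. t i \<noteq> 0" "(\<Sum>i<m. snd s0 (\<lambda>_. v i) * t i ^ d) = 0" by blast
      define V where "V = (\<lambda>x. \<Sum>i<m. t i * v i x)"
      have mixed: "snd s (\<lambda>l. v (\<phi> l)) = 0"
        if "s \<in> S" "\<phi> \<in> fst s \<rightarrow>\<^sub>E {..<m}" "\<And>i. \<not> (s = s0 \<and> \<phi> ` fst s = {i})" for s \<phi>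
      proof -
        \<comment> \<open>The largest index occurring in \<open>\<phi>\<close> tells at which stage
          this term was made to vanish.\<close>
        define i where "i = Max (\<phi> ` fst s)"
        have f: "finite (\<phi> ` fst s)" "\<phi> ` fst s \<noteq> {}" using sS[OF that(1)] by auto
        have i: "i \<in> \<phi> ` fst s" using Max_in[OF f] unfolding i_def .
        have "i < m" using i PiE_mem[OF that(2)] by auto
        moreover have "\<phi> \<in> fst s \<rightarrow>\<^sub>E {..i}"
          using that(2) Max_ge[OF f(1)] unfolding i_def by (auto simp: PiE_def extensional_def)
        ultimately show ?thesis using v[of i] i that(1,3) by blast
      qed
      have expand: "snd s (\<lambda>_. V) =
          (\<Sum>\<phi>\<in>fst s \<rightarrow>\<^sub>E {..<m}. (\<Prod>l\<in>fst s. t (\<phi> l)) * snd s (\<lambda>l. v (\<phi> l)))" if "s \<in> S" for s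
        unfolding V_def using sS[OF that] by (intro multilinear_on_sum) auto
      have "snd s (\<lambda>_. V) = 0" if s: "s \<in> S" for s
      proof (cases "s = s0")
        case False
        then show ?thesis unfolding expand[OF s] using mixed[OF s] by (intro sum.neutral) auto
      next
        case True
        have fE: "finite (fst s0)" and neE: "fst s0 \<noteq> {}" and ml: "multilinear_on (fst s0) (snd s0)"
          using sS[OF s0(1)] by auto
        \<comment> \<open>The constant choice functions, undefined outside the slots as the
          extensional function space demands. They index the terms that survive, and are distinct
          because there is at least one slot.\<close>
        define c where "c i = (\<lambda>l\<in>fst s0. i)" for i :: nat
        have inj: "inj_on c {..<m}"
          using neE unfolding c_def inj_on_def by (metis ex_in_conv restrict_apply')
        have "snd s0 (\<lambda>_. V) = (\<Sum>\<phi>\<in>c ` {..<m}. (\<Prod>l\<in>fst s0. t (\<phi> l)) * snd s0 (\<lambda>l. v (\<phi> l)))"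
          unfolding expand[OF s0(1)]
        proof (rule sum.mono_neutral_right)
          show "finite (fst s0 \<rightarrow>\<^sub>E {..<m})" using fE by (intro finite_PiE) auto
          show "c ` {..<m} \<subseteq> fst s0 \<rightarrow>\<^sub>E {..<m}" unfolding c_def by auto
          show "\<forall>\<phi>\<in>(fst s0 \<rightarrow>\<^sub>E {..<m}) - c ` {..<m}. (\<Prod>l\<in>fst s0. t (\<phi> l)) * snd s0 (\<lambda>l. v (\<phi> l)) = 0"
          proof
            fix \<phi> assume \<phi>: "\<phi> \<in> (fst s0 \<rightarrow>\<^sub>E {..<m}) - c ` {..<m}"
            have "\<phi> ` fst s0 \<noteq> {i}" for i
            proof
              assume eq: "\<phi> ` fst s0 = {i}"
              have "\<phi> = c i" using \<phi> eq unfolding c_def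
                by (intro ext) (auto simp: PiE_def extensional_def)
              moreover have "i < m"
              proof -
                obtain x where "x \<in> fst s0" "\<phi> x = i" using eq by blast
                then show ?thesis using \<phi> by (auto simp: PiE_def Pi_def)
              qed
              ultimately show False using \<phi> by auto
            qed
            then have "snd s0 (\<lambda>l. v (\<phi> l)) = 0" using mixed[OF s0(1)] \<phi> by blast
            then show "(\<Prod>l\<in>fst s0. t (\<phi> l)) * snd s0 (\<lambda>l. v (\<phi> l)) = 0" by simp
          qed
        qed
        also have "\<dots> = (\<Sum>i<m. (\<Prod>l\<in>fst s0. t (c i l)) * snd s0 (\<lambda>l. v (c i l)))"
          by (simp add: sum.reindex[OF inj])
        also have "\<dots> = (\<Sum>i<m. snd s0 (\<lambda>_. v i) * t i ^ d)"
        proof (rule sum.cong[OF refl])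
          fix i
          have "snd s0 (\<lambda>l. v (c i l)) = snd s0 (\<lambda>_. v i)"
            unfolding c_def by (rule multilinear_on_cong[OF ml]) simp
          moreover have "(\<Prod>l\<in>fst s0. t (c i l)) = t i ^ d" unfolding c_def using s0(2) by simp
          ultimately show "(\<Prod>l\<in>fst s0. t (c i l)) * snd s0 (\<lambda>l. v (c i l)) = snd s0 (\<lambda>_. v i) * t i ^ d"
            by simp
        qed
        finally show ?thesis using t(2) True by simp
      qed
      moreover have "V x = 0" if "x \<notin> B" for x
      proof -
        have "v i x = 0" if "i < m" for i using v[OF that] D[OF that] \<open>x \<notin> B\<close> by blast
        then show ?thesis unfolding V_def by simp
      qed
      moreover have "\<exists>x. V x \<noteq> 0"
      proof -
        obtain i where i: "i < m" "t i \<noteq> 0" using t(1) by auto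
        obtain x where x: "v i x \<noteq> 0" using v[OF i(1)] by auto
        then have xD: "x \<in> D i" using v[OF i(1)] by blast
        have "v j x = 0" if "j < m" "j \<noteq> i" for j
          using v[OF that(1)] disj[OF that(1) i(1) that(2)] xD by blast
        then have "V x = (\<Sum>j<m. if j = i then t i * v i x else 0)"
          unfolding V_def by (intro sum.cong) auto
        also have "\<dots> = t i * v i x" using i(1) by simp
        finally show ?thesis using i(2) x by (metis mult_eq_0_iff)
      qed
      ultimately show ?thesis by blast
    qed
  qed
  then show ?thesis by blast
qed

text \<open>Outer induction on \<open>d\<close>, inner on \<open>r\<close>, with \<open>q\<close>
  free in both. For \<open>r = 0\<close> the degree bound drops by one, and the total number
  \<open>q\<close> also bounds the forms of the new top degree.\<close>

lemma brauer_forms: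
  assumes "brauer_field TYPE('k::field)"
  shows "\<exists>N. \<forall>S :: 'k form_system. forms_upto d r q S \<longrightarrow> solvable_beyond N S"
proof (induction d arbitrary: r q)
  case 0
  have "solvable_beyond 0 S" if "forms_upto 0 r q S" for S :: "'k form_system"
  proof -
    have "S = {}" using that unfolding forms_upto_def by fastforce
    have "\<exists>v::nat \<Rightarrow> 'k. (\<forall>i. i \<notin> B \<longrightarrow> v i = 0) \<and> (\<exists>i. v i \<noteq> 0)" if "0 < card B" for B :: "nat set"
    proof -
      obtain b where "b \<in> B" using \<open>0 < card B\<close> by fastforce
      then show ?thesis by (intro exI[of _ "\<lambda>i. if i = b then 1 else 0"]) auto
    qed
    then show ?thesis using \<open>S = {}\<close> unfolding solvable_beyond_def by auto
  qed
  then show ?case by blast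
next
  case (Suc d)
  obtain N0 where N0: "\<forall>n>N0. \<forall>a::nat \<Rightarrow> 'k. \<exists>x::nat \<Rightarrow> 'k. (\<exists>i<n. x i \<noteq> 0) \<and> (\<Sum>i<n. a i * x i ^ Suc d) = 0"
    using assms unfolding brauer_field_def by (metis Suc_eq_plus1 le_add2)
  show ?case
  proof (induction r arbitrary: q)
    case 0
    have "forms_upto d q q S" if "forms_upto (Suc d) 0 q S" for S :: "'k form_system"
    proof -
      have "card {s\<in>S. card (fst s) = Suc d} = 0" "finite {s\<in>S. card (fst s) = Suc d}"
        using that unfolding forms_upto_def by (simp_all del: card_0_eq)
      then have "{s\<in>S. card (fst s) = Suc d} = {}" by (simp only: card_0_eq)
      then have "\<And>s. s \<in> S \<Longrightarrow> card (fst s) \<le> d"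
        using that unfolding forms_upto_def by (metis (mono_tags, lifting) empty_iff le_Suc_eq mem_Collect_eq)
      moreover have "card {s\<in>S. card (fst s) = d} \<le> card S"
        using that unfolding forms_upto_def by (intro card_mono) auto
      ultimately show ?thesis using that unfolding forms_upto_def by auto
    qed
    then show ?case using Suc.IH by metis
  next
    case (Suc r)
    show ?case by (rule solvable_step[OF N0 Suc.IH])
  qed
qed

text \<open>Gaussian elimination in reduced form: \<open>R\<close> is a set of free coordinates, and
  each equation costs at most one of them. The normalisation of \<open>w\<close> on \<open>R\<close>
  lets the coefficients of a combination be read off its coordinates, so a nontrivial combination is
  nonzero.\<close>

lemma common_kernel:
  fixes l :: "'j \<Rightarrow> 'a \<Rightarrow> 'k::field"
  assumes "finite J" and A: "finite A"
  shows "\<exists>R w. R \<subseteq> A \<and> card A \<le> card R + card J \<and>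
     (\<forall>r\<in>R. (\<forall>j\<in>J. (\<Sum>i\<in>A. l j i * w r i) = 0) \<and> (\<forall>i. i \<notin> A \<longrightarrow> w r i = 0) \<and>
        (\<forall>r'\<in>R. w r r' = (if r = r' then 1 else 0)))"
  using assms(1)
proof (induction J)
  case empty
  show ?case by (rule exI[of _ A], rule exI[of _ "\<lambda>r i. if r = i then 1 else 0"]) auto
next
  case (insert j J)
  then obtain R w where R: "R \<subseteq> A" "card A \<le> card R + card J"
    and w: "\<And>r. r \<in> R \<Longrightarrow> (\<forall>j\<in>J. (\<Sum>i\<in>A. l j i * w r i) = 0) \<and> (\<forall>i. i \<notin> A \<longrightarrow> w r i = 0) \<and>
        (\<forall>r'\<in>R. w r r' = (if r = r' then 1 else 0))" by blast
  define h where "h r = (\<Sum>i\<in>A. l j i * w r i)" for r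
  show ?case
  proof (cases "\<forall>r\<in>R. h r = 0")
    case True
    then show ?thesis using R w insert(1,2) unfolding h_def
      by (intro exI[of _ R] exI[of _ w]) auto
  next
    case False
    then obtain r0 where r0: "r0 \<in> R" "h r0 \<noteq> 0" by auto
    \<comment> \<open>Subtracting a multiple of \<open>w r0\<close> solves the new equation. The
      values on the rest of \<open>R\<close> are unchanged because \<open>w r0\<close> vanishes
      there.\<close>
    define w' where "w' r i = w r i - h r / h r0 * w r0 i" for r i
    have lin: "(\<Sum>i\<in>A. l j' i * w' r i) = (\<Sum>i\<in>A. l j' i * w r i) - h r / h r0 * (\<Sum>i\<in>A. l j' i * w r0 i)"
      for j' r
      unfolding w'_def by (simp add: right_diff_distrib sum_subtractf sum_distrib_left mult_ac)
    have "finite R" using R(1) A by (rule finite_subset)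
    then have "card A \<le> card (R - {r0}) + card (insert j J)"
      using R r0 insert(1,2) by (simp add: card_Diff_singleton)
    moreover have "(\<forall>j'\<in>insert j J. (\<Sum>i\<in>A. l j' i * w' r i) = 0) \<and> (\<forall>i. i \<notin> A \<longrightarrow> w' r i = 0) \<and>
        (\<forall>r'\<in>R - {r0}. w' r r' = (if r = r' then 1 else 0))" if r: "r \<in> R - {r0}" for r
    proof (intro conjI ballI allI impI)
      fix j' assume "j' \<in> insert j J"
      then consider "j' = j" | "j' \<in> J" by auto
      then show "(\<Sum>i\<in>A. l j' i * w' r i) = 0"
      proof cases
        case 1
        then show ?thesis unfolding lin using r0(2) by (simp add: h_def[symmetric])
      next
        case 2
        then show ?thesis unfolding lin using w r r0(1) by simp
      qed
    next
      fix i assume "i \<notin> A"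
      then show "w' r i = 0" unfolding w'_def using w r r0(1) by simp
    next
      fix r' assume r': "r' \<in> R - {r0}"
      have "w r0 r' = 0" "w r r' = (if r = r' then 1 else 0)" using w r r' r0(1) by auto
      then show "w' r r' = (if r = r' then 1 else 0)" unfolding w'_def by simp
    qed
    moreover have "R - {r0} \<subseteq> A" using R(1) by auto
    ultimately show ?thesis by blast
  qed
qed

section \<open>The polynomial ring\<close>

definition mconst :: "'k::zero \<Rightarrow> 'k mpoly" where "mconst c = Poly_Mapping.single 0 c"

definition mvar :: "nat \<Rightarrow> 'k::zero_neq_one mpoly" where
  "mvar i = Poly_Mapping.single (Poly_Mapping.single i 1) 1"

lemma poly_ring_iff: "p \<in> poly_ring n \<longleftrightarrow> (\<forall>m\<in>Poly_Mapping.keys p. Poly_Mapping.keys m \<subseteq> {..<n})"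
  unfolding poly_ring_def mpoly_vars_def by auto

lemma single_in_poly_ring: "Poly_Mapping.keys m \<subseteq> {..<n} \<Longrightarrow> Poly_Mapping.single m c \<in> poly_ring n"
  unfolding poly_ring_iff by simp

lemma mconst_in_poly_ring [simp]: "mconst c \<in> poly_ring n"
  unfolding mconst_def by (rule single_in_poly_ring) simp

lemma mvar_in_poly_ring: "i < n \<Longrightarrow> mvar i \<in> poly_ring n"
  unfolding mvar_def by (rule single_in_poly_ring) simp

lemma mconst_one: "mconst 1 = 1"
  unfolding mconst_def by simp

lemma mconst_mult: "mconst (a * b) = mconst a * (mconst b :: 'k::comm_ring_1 mpoly)"
  unfolding mconst_def by (simp add: mult_single)

lemma lookup_mconst_mult:
  "Poly_Mapping.lookup (mconst c * p) m = c * Poly_Mapping.lookup (p :: 'k::comm_ring_1 mpoly) m"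
  unfolding mconst_def mult_map_scale_conv_mult[symmetric] by transfer (simp add: when_def)

lemma is_subring_poly_ring: "is_subring (poly_ring n :: 'k::comm_ring_1 mpoly set)"
  unfolding is_subring_def
proof (intro conjI ballI)
  show "1 \<in> (poly_ring n :: 'k mpoly set)" unfolding mconst_one[symmetric] by (rule mconst_in_poly_ring)
  fix a b :: "'k mpoly" assume ab: "a \<in> poly_ring n" "b \<in> poly_ring n"
  show "a - b \<in> poly_ring n" using ab keys_diff[of a b] unfolding poly_ring_iff by blast
  show "a * b \<in> poly_ring n" unfolding poly_ring_iff
  proof
    fix m assume "m \<in> Poly_Mapping.keys (a * b)"
    then obtain m1 m2 where "m = m1 + m2" "m1 \<in> Poly_Mapping.keys a" "m2 \<in> Poly_Mapping.keys b"
      using keys_mult[of a b] by auto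
    then show "Poly_Mapping.keys m \<subseteq> {..<n}" using ab keys_add[of m1 m2] unfolding poly_ring_iff by blast
  qed
qed

lemmas poly_ring_simps = is_subring_simps[OF is_subring_poly_ring]

lemma poly_ring_sum: "(\<And>i. i \<in> A \<Longrightarrow> f i \<in> poly_ring n) \<Longrightarrow> sum f A \<in> (poly_ring n :: 'k::comm_ring_1 mpoly set)"
  by (induction A rule: infinite_finite_induct) (auto intro: poly_ring_simps)

lemma poly_ring_power: "a \<in> poly_ring n \<Longrightarrow> a ^ e \<in> (poly_ring n :: 'k::comm_ring_1 mpoly set)"
  by (induction e) (auto intro: poly_ring_simps)

lemma mpoly_sum_single:
  "(\<Sum>m\<in>Poly_Mapping.keys p. Poly_Mapping.single m (Poly_Mapping.lookup p m)) = (p :: 'k::comm_ring_1 mpoly)"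
proof (rule poly_mapping_eqI)
  fix k
  have "Poly_Mapping.lookup (\<Sum>m\<in>Poly_Mapping.keys p. Poly_Mapping.single m (Poly_Mapping.lookup p m)) k
    = (\<Sum>m\<in>Poly_Mapping.keys p. if m = k then Poly_Mapping.lookup p k else 0)"
    unfolding lookup_sum by (intro sum.cong) (auto simp: lookup_single when_def)
  also have "\<dots> = Poly_Mapping.lookup p k" by (auto simp: in_keys_iff)
  finally show "Poly_Mapping.lookup (\<Sum>m\<in>Poly_Mapping.keys p. Poly_Mapping.single m (Poly_Mapping.lookup p m)) k =
    Poly_Mapping.lookup p k" .
qed

lemma mvar_power: "mvar i ^ e = (Poly_Mapping.single (Poly_Mapping.single i e) 1 :: 'k::comm_ring_1 mpoly)"
  by (induction e) (simp_all add: mvar_def mult_single single_add[symmetric])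

text \<open>Terms are sorted by the exponent of the last variable; \<open>r m\<close> is the
  monomial \<open>m\<close> with that variable removed.\<close>

lemma poly_ring_Suc_expand:
  fixes p :: "'k::comm_ring_1 mpoly"
  assumes "p \<in> poly_ring (Suc n)"
  shows "\<exists>d c. (\<forall>i. c i \<in> poly_ring n) \<and> p = (\<Sum>i\<le>d. c i * mvar n ^ i)"
proof -
  define e where "e m = Poly_Mapping.lookup m n" for m :: "nat \<Rightarrow>\<^sub>0 nat"
  define r where "r m = m - Poly_Mapping.single n (e m)" for m :: "nat \<Rightarrow>\<^sub>0 nat"
  define d where "d = Max (insert 0 (e ` Poly_Mapping.keys p))"
  define c where "c i = (\<Sum>m\<in>{m\<in>Poly_Mapping.keys p. e m = i}. Poly_Mapping.single (r m) (Poly_Mapping.lookup p m))" for i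
  have r: "m = r m + Poly_Mapping.single n (e m)" for m
    unfolding r_def e_def by (rule poly_mapping_eqI) (simp add: lookup_add lookup_minus lookup_single when_def)
  have "Poly_Mapping.keys (r m) \<subseteq> {..<n}" if "m \<in> Poly_Mapping.keys p" for m
  proof
    fix i assume i: "i \<in> Poly_Mapping.keys (r m)"
    then have "i \<noteq> n" unfolding r_def e_def in_keys_iff by (auto simp: lookup_minus)
    moreover have "i \<in> Poly_Mapping.keys m"
      using i unfolding r_def in_keys_iff by (auto simp: lookup_minus)
    then have "i < Suc n" using assms that unfolding poly_ring_iff by blast
    ultimately show "i \<in> {..<n}" by simp
  qed
  then have "\<forall>i. c i \<in> poly_ring n" unfolding c_def by (auto intro!: poly_ring_sum single_in_poly_ring)
  moreover have "p = (\<Sum>i\<le>d. c i * mvar n ^ i)"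
  proof -
    have "(\<Sum>i\<le>d. c i * mvar n ^ i) =
      (\<Sum>i\<le>d. \<Sum>m\<in>{m\<in>Poly_Mapping.keys p. e m = i}. Poly_Mapping.single m (Poly_Mapping.lookup p m))"
      unfolding c_def sum_distrib_right
    proof (intro sum.cong refl)
      fix i m assume "m \<in> {m\<in>Poly_Mapping.keys p. e m = i}"
      then have "r m + Poly_Mapping.single n i = m" using r[of m] by simp
      then show "Poly_Mapping.single (r m) (Poly_Mapping.lookup p m) * mvar n ^ i =
          Poly_Mapping.single m (Poly_Mapping.lookup p m)"
        unfolding mvar_power by (simp add: mult_single)
    qed
    also have "\<dots> = (\<Sum>m\<in>Poly_Mapping.keys p. Poly_Mapping.single m (Poly_Mapping.lookup p m))"
      unfolding d_def by (intro sum.group) auto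
    finally show ?thesis unfolding mpoly_sum_single by simp
  qed
  ultimately show ?thesis by blast
qed

lemma poly_ring_0: "p \<in> poly_ring 0 \<Longrightarrow> p = mconst (Poly_Mapping.lookup p 0)"
  unfolding mconst_def poly_ring_iff
  by (intro poly_mapping_eqI) (auto simp: lookup_single when_def in_keys_iff)

lemma ideal_of_poly_ring_unit:
  fixes J :: "'k::field mpoly set"
  assumes "ideal_of (poly_ring n) J" "mconst c \<in> J" "c \<noteq> 0"
  shows "1 \<in> J"
proof -
  have "mconst (inverse c) * mconst c \<in> J" by (rule ideal_ofD(4)[OF assms(1,2)]) simp
  then show ?thesis using assms(3) by (simp add: mconst_mult[symmetric] mconst_one)
qed

text \<open>Hilbert's theorem adds one variable at a time. The base ring consists of the constants,
  a field, whose only ideals are zero and the whole ring.\<close>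

lemma noetherian_poly_ring: "noetherian_subring (poly_ring n :: 'k::field mpoly set)"
proof (induction n)
  case 0
  show ?case
    unfolding noetherian_subring_def
  proof (intro conjI allI impI is_subring_poly_ring)
    fix I :: "nat \<Rightarrow> 'k mpoly set"
    assume I: "\<forall>j. ideal_of (poly_ring 0) (I j)" and "\<forall>j. I j \<subseteq> I (Suc j)"
    then have mono: "I i \<subseteq> I j" if "i \<le> j" for i j using lift_Suc_mono_le[of I] that by blast
    show "\<exists>N. \<forall>j\<ge>N. I j = I N"
    proof (cases "\<exists>N. \<exists>a\<in>I N. a \<noteq> 0")
      case True
      then obtain N a where a: "a \<in> I N" "a \<noteq> 0" by auto
      have "I j = poly_ring 0" if "N \<le> j" for j
      proof
        show "I j \<subseteq> poly_ring 0" using I ideal_ofD(1) by blast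
        have aj: "a \<in> I j" using mono[OF that] a by blast
        have "a = mconst (Poly_Mapping.lookup a 0)"
          using aj I ideal_ofD(1) by (intro poly_ring_0) blast
        moreover from this have "Poly_Mapping.lookup a 0 \<noteq> 0" using a(2) by (auto simp: mconst_def)
        ultimately have "1 \<in> I j" using ideal_of_poly_ring_unit I aj by metis
        then show "poly_ring 0 \<subseteq> I j" using ideal_ofD(4) I by (metis mult.right_neutral subsetI)
      qed
      then show ?thesis by (metis order_refl)
    next
      case False
      then have "I j = {0}" for j using ideal_ofD(2) I by blast
      then show ?thesis by auto
    qed
  qed
next
  case (Suc n)
  show ?case
    by (rule hilbert_basis[OF Suc is_subring_poly_ring _ mvar_in_poly_ring[OF lessI] poly_ring_Suc_expand])
      (fastforce simp: poly_ring_iff)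
qed

section \<open>Evaluation of polynomials at points\<close>

definition mon_eval :: "(nat \<Rightarrow>\<^sub>0 nat) \<Rightarrow> (nat \<Rightarrow> 'k::comm_ring_1) \<Rightarrow> 'k" where
  "mon_eval m x = (\<Prod>i\<in>Poly_Mapping.keys m. x i ^ Poly_Mapping.lookup m i)"

lemma mon_eval_superset:
  "finite S \<Longrightarrow> Poly_Mapping.keys m \<subseteq> S \<Longrightarrow> mon_eval m x = (\<Prod>i\<in>S. x i ^ Poly_Mapping.lookup m i)"
  unfolding mon_eval_def by (intro prod.mono_neutral_left) (auto simp: in_keys_iff)

lemma mon_eval_add: "mon_eval (m + m') x = mon_eval m x * mon_eval m' x"
proof -
  let ?S = "Poly_Mapping.keys m \<union> Poly_Mapping.keys m'"
  have "mon_eval (m + m') x = (\<Prod>i\<in>?S. x i ^ Poly_Mapping.lookup (m + m') i)"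
    using keys_add[of m m'] by (intro mon_eval_superset) auto
  also have "\<dots> = (\<Prod>i\<in>?S. x i ^ Poly_Mapping.lookup m i) * (\<Prod>i\<in>?S. x i ^ Poly_Mapping.lookup m' i)"
    by (simp add: lookup_add power_add prod.distrib)
  also have "\<dots> = mon_eval m x * mon_eval m' x"
    using mon_eval_superset[of ?S m x] mon_eval_superset[of ?S m' x] by simp
  finally show ?thesis .
qed

lemma eval_mpoly_superset:
  "finite S \<Longrightarrow> Poly_Mapping.keys p \<subseteq> S \<Longrightarrow>
     eval_mpoly p x = (\<Sum>m\<in>S. Poly_Mapping.lookup p m * mon_eval m (x :: nat \<Rightarrow> 'k::comm_ring_1))"
  unfolding eval_mpoly_def mon_eval_def by (intro sum.mono_neutral_left) (auto simp: in_keys_iff)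

lemma eval_mpoly_zero [simp]: "eval_mpoly 0 x = 0"
  unfolding eval_mpoly_def by simp

lemma eval_mpoly_add: "eval_mpoly (p + q) x = eval_mpoly p x + eval_mpoly q (x :: nat \<Rightarrow> 'k::comm_ring_1)"
proof -
  let ?S = "Poly_Mapping.keys p \<union> Poly_Mapping.keys q"
  have "eval_mpoly (p + q) x = (\<Sum>m\<in>?S. Poly_Mapping.lookup (p + q) m * mon_eval m x)"
    using keys_add[of p q] by (intro eval_mpoly_superset) auto
  also have "\<dots> = (\<Sum>m\<in>?S. Poly_Mapping.lookup p m * mon_eval m x) + (\<Sum>m\<in>?S. Poly_Mapping.lookup q m * mon_eval m x)"
    by (simp add: lookup_add distrib_right sum.distrib)
  also have "\<dots> = eval_mpoly p x + eval_mpoly q x"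
    using eval_mpoly_superset[of ?S p x] eval_mpoly_superset[of ?S q x] by simp
  finally show ?thesis .
qed

lemma eval_mpoly_sum: "eval_mpoly (sum f A) x = (\<Sum>i\<in>A. eval_mpoly (f i) (x :: nat \<Rightarrow> 'k::comm_ring_1))"
  by (induction A rule: infinite_finite_induct) (auto simp: eval_mpoly_add)

lemma eval_mpoly_single: "eval_mpoly (Poly_Mapping.single m c) x = c * mon_eval m (x :: nat \<Rightarrow> 'k::comm_ring_1)"
  using eval_mpoly_superset[of "{m}" "Poly_Mapping.single m c" x] by simp

lemma eval_mpoly_mult: "eval_mpoly (p * q) x = eval_mpoly p x * eval_mpoly q (x :: nat \<Rightarrow> 'k::comm_ring_1)"
proof -
  have "p * q = (\<Sum>m\<in>Poly_Mapping.keys p. \<Sum>m'\<in>Poly_Mapping.keys q.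
      Poly_Mapping.single (m + m') (Poly_Mapping.lookup p m * Poly_Mapping.lookup q m'))"
    by (subst (1 2) mpoly_sum_single[symmetric]) (simp only: sum_product mult_single)
  then have "eval_mpoly (p * q) x = (\<Sum>m\<in>Poly_Mapping.keys p. \<Sum>m'\<in>Poly_Mapping.keys q.
      (Poly_Mapping.lookup p m * mon_eval m x) * (Poly_Mapping.lookup q m' * mon_eval m' x))"
    by (simp add: eval_mpoly_sum eval_mpoly_single mon_eval_add mult_ac)
  also have "\<dots> = eval_mpoly p x * eval_mpoly q x"
    unfolding eval_mpoly_def mon_eval_def sum_product ..
  finally show ?thesis .
qed

lemma eval_mpoly_mconst [simp]: "eval_mpoly (mconst c) (x :: nat \<Rightarrow> 'k::comm_ring_1) = c"
  unfolding mconst_def eval_mpoly_single by (simp add: mon_eval_def)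

lemma eval_mpoly_one [simp]: "eval_mpoly 1 (x :: nat \<Rightarrow> 'k::comm_ring_1) = 1"
  using eval_mpoly_mconst[of 1] by (simp add: mconst_one)

lemma eval_mpoly_mvar [simp]: "eval_mpoly (mvar i) (x :: nat \<Rightarrow> 'k::comm_ring_1) = x i"
  unfolding mvar_def eval_mpoly_single by (simp add: mon_eval_def)

section \<open>Chains of primes have length at most the number of variables\<close>

lemma prime_ideal_ideal_of: "prime_ideal_in n P \<Longrightarrow> ideal_of (poly_ring n) P"
  unfolding prime_ideal_in_def ideal_of_def by blast

lemma prime_ideal_multD:
  "prime_ideal_in n P \<Longrightarrow> a \<in> poly_ring n \<Longrightarrow> b \<in> poly_ring n \<Longrightarrow> a * b \<in> P \<Longrightarrow> a \<in> P \<or> b \<in> P"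
  unfolding prime_ideal_in_def by blast

lemma prime_ideal_one: "prime_ideal_in n P \<Longrightarrow> 1 \<notin> P"
  unfolding prime_ideal_in_def by blast

lemma prime_ideal_powerD:
  assumes "prime_ideal_in n P" "a \<in> poly_ring n" "a ^ e \<in> P"
  shows "a \<in> P"
  using assms(3)
proof (induction e)
  case 0
  then show ?case using prime_ideal_one[OF assms(1)] by simp
next
  case (Suc e)
  then show ?case using prime_ideal_multD[OF assms(1,2) poly_ring_power[OF assms(2)]] by auto
qed

definition power_product :: "'a::comm_ring_1 list \<Rightarrow> nat list \<Rightarrow> 'a" where
  "power_product as \<alpha> = prod_list (map2 (^) as \<alpha>)"

lemma power_product_Nil [simp]: "power_product [] \<alpha> = 1" "power_product as [] = 1"
  unfolding power_product_def by auto

lemma power_product_Cons [simp]: "power_product (a # as) (e # \<alpha>) = a ^ e * power_product as \<alpha>"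
  unfolding power_product_def by simp

lemma power_product_in_poly_ring:
  "set as \<subseteq> poly_ring n \<Longrightarrow> power_product as \<alpha> \<in> (poly_ring n :: 'k::comm_ring_1 mpoly set)"
proof (induction as arbitrary: \<alpha>)
  case Nil
  show ?case using poly_ring_simps(1) by simp
next
  case (Cons a as)
  then show ?case
    by (cases \<alpha>) (auto intro: poly_ring_simps poly_ring_power)
qed

text \<open>The lowest power of \<open>a = as ! 0\<close> occurring in the relation can be cancelled because \<open>a\<close> is
  not in the prime \<open>P 0\<close>; the terms still divisible by \<open>a\<close> then die modulo \<open>P 1\<close>.\<close>

lemma relation_not_in_bottom_of_chain:
  fixes c :: "nat list \<Rightarrow> 'k::field"
  assumes "\<forall>i\<le>length as. prime_ideal_in n (P i)"
    and "\<forall>i<length as. P i \<subseteq> P (Suc i) \<and> as ! i \<in> P (Suc i) - P i"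
    and "finite A" and "A \<noteq> {}" and "\<forall>\<alpha>\<in>A. length \<alpha> = length as \<and> c \<alpha> \<noteq> 0"
  shows "(\<Sum>\<alpha>\<in>A. mconst (c \<alpha>) * power_product as \<alpha>) \<notin> P 0"
  using assms
proof (induction as arbitrary: P A c)
  case Nil
  then have A: "A = {[]}" by auto
  then have "c [] \<noteq> 0" using Nil by auto
  then show ?case
    using ideal_of_poly_ring_unit[OF prime_ideal_ideal_of, of n "P 0" "c []"] Nil(1) prime_ideal_one
    by (auto simp: A)
next
  case (Cons a as)
  have P0: "prime_ideal_in n (P 0)" and P1: "prime_ideal_in n (P 1)" using Cons.prems(1) by auto
  have a: "a \<in> P 1" "a \<notin> P 0" and sub: "P 0 \<subseteq> P 1" using Cons.prems(2) by auto
  have aR: "a \<in> poly_ring n" using a(1) ideal_ofD(1)[OF prime_ideal_ideal_of[OF P1]] by blast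
  have asR: "set as \<subseteq> poly_ring n"
  proof
    fix b assume "b \<in> set as"
    then obtain i where i: "i < length as" "b = as ! i" by (auto simp: in_set_conv_nth)
    then have "b \<in> P (Suc (Suc i))" "prime_ideal_in n (P (Suc (Suc i)))" using Cons.prems(1,2) by auto
    then show "b \<in> poly_ring n" using ideal_ofD(1)[OF prime_ideal_ideal_of] by blast
  qed
  \<comment> \<open>\<open>e\<close> is the least exponent of \<open>a\<close>. Terms with exactly
    this exponent make up \<open>Q\<close>; the others keep a further factor \<open>a\<close> and
    make up \<open>a * R\<close>. The relation becomes \<open>a ^ e * (a * R + Q)\<close>.\<close>
  define e where "e = Min (hd ` A)"
  define B where "B = {\<beta>. e # \<beta> \<in> A}"
  define A1 where "A1 = A - (#) e ` B"
  define Q where "Q = (\<Sum>\<beta>\<in>B. mconst (c (e # \<beta>)) * power_product as \<beta>)"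
  define R where "R = (\<Sum>\<alpha>\<in>A1. mconst (c \<alpha>) * a ^ (hd \<alpha> - e - 1) * power_product as (tl \<alpha>))"
  have ne: "\<alpha> = hd \<alpha> # tl \<alpha>" if "\<alpha> \<in> A" for \<alpha>
    using Cons.prems(5) that by (cases \<alpha>) auto
  have e_le: "e \<le> hd \<alpha>" if "\<alpha> \<in> A" for \<alpha> unfolding e_def using Cons.prems(3) that by (intro Min_le) auto
  have "e \<in> hd ` A" unfolding e_def using Cons.prems(3,4) by (intro Min_in) auto
  then obtain \<alpha>0 where "\<alpha>0 \<in> A" "e = hd \<alpha>0" by blast
  then have "tl \<alpha>0 \<in> B" unfolding B_def using ne[of \<alpha>0] by simp
  then have "B \<noteq> {}" by blast
  have "(#) e ` B \<subseteq> A" unfolding B_def by auto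
  then have "finite ((#) e ` B)" using Cons.prems(3) by (rule finite_subset)
  then have finB: "finite B" by (rule finite_imageD) simp
  have "(\<Sum>\<alpha>\<in>A. mconst (c \<alpha>) * power_product (a # as) \<alpha>) =
      (\<Sum>\<alpha>\<in>A1. mconst (c \<alpha>) * power_product (a # as) \<alpha>) +
      (\<Sum>\<alpha>\<in>(#) e ` B. mconst (c \<alpha>) * power_product (a # as) \<alpha>)"
    unfolding A1_def using \<open>(#) e ` B \<subseteq> A\<close> Cons.prems(3) by (rule sum.subset_diff)
  also have "(\<Sum>\<alpha>\<in>(#) e ` B. mconst (c \<alpha>) * power_product (a # as) \<alpha>) = a ^ e * Q"
    unfolding Q_def by (subst sum.reindex) (auto simp: sum_distrib_left mult_ac)
  also have "(\<Sum>\<alpha>\<in>A1. mconst (c \<alpha>) * power_product (a # as) \<alpha>) = a ^ e * (a * R)"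
    unfolding R_def sum_distrib_left
  proof (rule sum.cong[OF refl])
    fix \<alpha> assume "\<alpha> \<in> A1"
    then have A: "\<alpha> \<in> A" and "\<alpha> \<notin> (#) e ` B" unfolding A1_def by auto
    then have "hd \<alpha> \<noteq> e" using ne[OF A] unfolding B_def by (metis imageI mem_Collect_eq)
    then have "hd \<alpha> = e + Suc (hd \<alpha> - e - 1)" using e_le[OF A] by simp
    then have "a ^ hd \<alpha> = a ^ e * (a * a ^ (hd \<alpha> - e - 1))" by (simp only: power_add[symmetric] power_Suc[symmetric])
    moreover have "power_product (a # as) \<alpha> = a ^ hd \<alpha> * power_product as (tl \<alpha>)"
      by (subst ne[OF A]) simp
    ultimately show "mconst (c \<alpha>) * power_product (a # as) \<alpha> =
        a ^ e * (a * (mconst (c \<alpha>) * a ^ (hd \<alpha> - e - 1) * power_product as (tl \<alpha>)))"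
      by (simp add: mult_ac)
  qed
  finally have eq: "(\<Sum>\<alpha>\<in>A. mconst (c \<alpha>) * power_product (a # as) \<alpha>) = a ^ e * (a * R + Q)"
    by (simp add: distrib_left)
  have QR: "Q \<in> poly_ring n" unfolding Q_def
    by (intro poly_ring_sum poly_ring_simps power_product_in_poly_ring asR) simp
  have RR: "R \<in> poly_ring n" unfolding R_def
    by (intro poly_ring_sum poly_ring_simps power_product_in_poly_ring poly_ring_power asR aR) simp
  have "Q \<notin> P (Suc 0)"
    unfolding Q_def
  \<comment> \<open>The tails form a relation for the chain shifted by one, so \<open>Q\<close> is
    nonzero modulo its bottom prime.\<close>
  proof (rule Cons.IH[of "\<lambda>i. P (Suc i)" B "\<lambda>\<beta>. c (e # \<beta>)"])
    show "\<forall>i\<le>length as. prime_ideal_in n (P (Suc i))" using Cons.prems(1) by simp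
    show "\<forall>i<length as. P (Suc i) \<subseteq> P (Suc (Suc i)) \<and> as ! i \<in> P (Suc (Suc i)) - P (Suc i)"
      using Cons.prems(2) by auto
    show "\<forall>\<beta>\<in>B. length \<beta> = length as \<and> c (e # \<beta>) \<noteq> 0" using Cons.prems(5) unfolding B_def by auto
  qed (fact finB, fact)
  show ?case
  proof
    assume "(\<Sum>\<alpha>\<in>A. mconst (c \<alpha>) * power_product (a # as) \<alpha>) \<in> P 0"
    then have "a ^ e * (a * R + Q) \<in> P 0" using eq by simp
    then have "a * R + Q \<in> P 0"
      using prime_ideal_multD[OF P0 poly_ring_power[OF aR] poly_ring_simps(6)[OF poly_ring_simps(4)[OF aR RR] QR]]
        prime_ideal_powerD[OF P0 aR] a(2) by blast
    then have 1: "a * R + Q \<in> P 1" using sub by blast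
    have "R * a \<in> P 1" by (rule ideal_ofD(4)[OF prime_ideal_ideal_of[OF P1] a(1) RR])
    from ideal_of_diff[OF is_subring_poly_ring prime_ideal_ideal_of[OF P1] 1 this]
    show False using \<open>Q \<notin> P (Suc 0)\<close> by (simp add: mult.commute)
  qed
qed

section \<open>Algebraic dependence by counting monomials\<close>

definition exponents_le :: "nat \<Rightarrow> 'k::zero mpoly \<Rightarrow> bool" where
  "exponents_le e p \<longleftrightarrow> (\<forall>m\<in>Poly_Mapping.keys p. \<forall>v. Poly_Mapping.lookup m v \<le> e)"

lemma exponents_le_one [simp]: "exponents_le e (1 :: 'k::comm_ring_1 mpoly)"
  unfolding exponents_le_def by simp

lemma exponents_le_mono: "exponents_le e p \<Longrightarrow> e \<le> e' \<Longrightarrow> exponents_le e' p"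
  unfolding exponents_le_def using le_trans by blast

lemma exponents_le_mult:
  assumes "exponents_le e p" "exponents_le e' q"
  shows "exponents_le (e + e') (p * q :: 'k::comm_ring_1 mpoly)"
  unfolding exponents_le_def
proof (intro ballI allI)
  fix m v assume "m \<in> Poly_Mapping.keys (p * q)"
  then obtain m1 m2 where "m = m1 + m2" "m1 \<in> Poly_Mapping.keys p" "m2 \<in> Poly_Mapping.keys q"
    using keys_mult[of p q] by auto
  then show "Poly_Mapping.lookup m v \<le> e + e'"
    using assms unfolding exponents_le_def by (simp add: lookup_add add_mono)
qed

lemma exponents_le_power:
  "exponents_le e p \<Longrightarrow> exponents_le (k * e) (p ^ k :: 'k::comm_ring_1 mpoly)"
  by (induction k) (auto intro: exponents_le_mult)

lemma exponents_le_power_product: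
  assumes "\<forall>a\<in>set as. exponents_le e (a :: 'k::comm_ring_1 mpoly)" "\<forall>k\<in>set \<alpha>. k \<le> D"
  shows "exponents_le (length as * (D * e)) (power_product as \<alpha>)"
  using assms
proof (induction as arbitrary: \<alpha>)
  case (Cons a as)
  show ?case
  proof (cases \<alpha>)
    case (Cons k \<beta>)
    have "exponents_le (D * e) (a ^ k)"
      using Cons.prems Cons
      by (intro exponents_le_mono[OF exponents_le_power[of e]] mult_le_mono1) auto
    then have "exponents_le (D * e + length as * (D * e)) (a ^ k * power_product as \<beta>)"
      using Cons.prems Cons by (intro exponents_le_mult Cons.IH) auto
    then show ?thesis using Cons by simp
  qed simp
qed simp

lemma finite_exponents_le: "\<exists>e. \<forall>a\<in>set as. exponents_le e (a :: 'k::zero mpoly)"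
proof (induction as)
  case (Cons a as)
  then obtain e where e: "\<forall>a\<in>set as. exponents_le e a" by blast
  define E where "E = (\<Union>m\<in>Poly_Mapping.keys a. Poly_Mapping.lookup m ` Poly_Mapping.keys m)"
  have "exponents_le (Max (insert 0 E)) a"
    unfolding exponents_le_def
  proof (intro ballI allI)
    fix m v assume m: "m \<in> Poly_Mapping.keys a"
    show "Poly_Mapping.lookup m v \<le> Max (insert 0 E)"
    proof (cases "v \<in> Poly_Mapping.keys m")
      case True
      then show ?thesis using m unfolding E_def by (intro Max_ge) auto
    qed (simp add: in_keys_iff)
  qed
  then have "\<forall>b\<in>set (a # as). exponents_le (max e (Max (insert 0 E))) b"
    using e by (auto intro: exponents_le_mono)
  then show ?case by blast
qed simp

text \<open>Bounding each exponent separately, not the total degree, makes the monomials a box of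
  exponent vectors, so that the count is a plain power.\<close>

lemma card_monomials:
  defines "M \<equiv> \<lambda>n e. {m :: nat \<Rightarrow>\<^sub>0 nat. Poly_Mapping.keys m \<subseteq> {..<n} \<and> (\<forall>v. Poly_Mapping.lookup m v \<le> e)}"
  shows "finite (M n e)" "card (M n e) \<le> (e + 1) ^ n"
proof -
  let ?f = "\<lambda>m. map (Poly_Mapping.lookup m) [0..<n]" and ?L = "{xs. set xs \<subseteq> {..e} \<and> length xs = n}"
  have inj: "inj_on ?f (M n e)"
  proof (rule inj_onI, rule poly_mapping_eqI)
    fix m m' v assume M: "m \<in> M n e" "m' \<in> M n e" and eq: "?f m = ?f m'"
    show "Poly_Mapping.lookup m v = Poly_Mapping.lookup m' v"
    proof (cases "v < n")
      case True
      then show ?thesis using eq by (auto simp: map_eq_conv)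
    next
      case False
      then have "v \<notin> Poly_Mapping.keys m" "v \<notin> Poly_Mapping.keys m'" using M unfolding M_def by auto
      then show ?thesis by (simp add: in_keys_iff)
    qed
  qed
  have sub: "?f ` M n e \<subseteq> ?L" unfolding M_def by auto
  have fin: "finite ?L" by (rule finite_lists_length_eq) simp
  show "finite (M n e)" using finite_subset[OF sub fin] inj by (rule finite_imageD)
  have "card (M n e) \<le> card ?L" by (rule card_inj_on_le[OF inj sub fin])
  also have "\<dots> = (e + 1) ^ n" by (subst card_lists_length_eq) auto
  finally show "card (M n e) \<le> (e + 1) ^ n" .
qed

text \<open>There are about \<open>D ^ (n + 1)\<close> power products with exponents at most \<open>D\<close>, but they involve
  only \<open>O(D ^ n)\<close> monomials.\<close>

lemma algebraic_relation:
  fixes as :: "'k::field mpoly list"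
  assumes R: "set as \<subseteq> poly_ring n" and len: "length as = Suc n"
  shows "\<exists>A c. finite A \<and> A \<noteq> {} \<and> (\<forall>\<alpha>\<in>A. length \<alpha> = length as \<and> c \<alpha> \<noteq> (0::'k)) \<and>
     (\<Sum>\<alpha>\<in>A. mconst (c \<alpha>) * power_product as \<alpha>) = 0"
proof -
  obtain e where e: "\<forall>a\<in>set as. exponents_le e a" using finite_exponents_le by blast
  \<comment> \<open>Chosen so that (n + 1) D e + 1 <= K (D + 1). With D = K^n there are at most K^n
    (D + 1)^n = D (D + 1)^n monomials, fewer than the (D + 1)^(n + 1) power products.\<close>
  define K where "K = Suc n * e + 1"
  define D where "D = K ^ n"
  define L where "L = {\<alpha>. set \<alpha> \<subseteq> {..D} \<and> length \<alpha> = Suc n}"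
  define M where "M = {m :: nat \<Rightarrow>\<^sub>0 nat. Poly_Mapping.keys m \<subseteq> {..<n} \<and> (\<forall>v. Poly_Mapping.lookup m v \<le> Suc n * (D * e))}"
  have finL: "finite L" unfolding L_def by (rule finite_lists_length_eq) simp
  have cardL: "card L = (D + 1) ^ Suc n" unfolding L_def by (subst card_lists_length_eq) auto
  have finM: "finite M" unfolding M_def by (rule card_monomials)
  have "card M \<le> (Suc n * (D * e) + 1) ^ n" unfolding M_def by (rule card_monomials)
  also have "\<dots> \<le> (K * (D + 1)) ^ n"
    unfolding K_def by (intro power_mono) (auto simp: algebra_simps)
  also have "\<dots> = D * (D + 1) ^ n" unfolding D_def power_mult_distrib ..
  also have "\<dots> < card L" unfolding cardL by simp
  finally have lt: "card M < card L" .
  \<comment> \<open>One equation per monomial, one unknown per power product: a free coordinate is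
    left, and its solution has an entry 1.\<close>
  obtain Rs w where Rs: "Rs \<subseteq> L" "card L \<le> card Rs + card M"
    and w: "\<And>r. r \<in> Rs \<Longrightarrow> (\<forall>m\<in>M. (\<Sum>\<alpha>\<in>L. Poly_Mapping.lookup (power_product as \<alpha>) m * w r \<alpha>) = 0) \<and>
      (\<forall>\<alpha>. \<alpha> \<notin> L \<longrightarrow> w r \<alpha> = 0) \<and> (\<forall>r'\<in>Rs. w r r' = (if r = r' then 1 else 0))"
    using common_kernel[OF finM finL, of "\<lambda>m \<alpha>. Poly_Mapping.lookup (power_product as \<alpha>) m"] by blast
  have "Rs \<noteq> {}" using Rs(2) lt by auto
  then obtain r where r: "r \<in> Rs" by blast
  define c where "c = w r"
  define A where "A = {\<alpha>\<in>L. c \<alpha> \<noteq> 0}"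
  have "r \<in> A" unfolding A_def c_def using r Rs(1) w[OF r] by auto
  have "(\<Sum>\<alpha>\<in>A. mconst (c \<alpha>) * power_product as \<alpha>) = (\<Sum>\<alpha>\<in>L. mconst (c \<alpha>) * power_product as \<alpha>)"
    unfolding A_def using finL by (intro sum.mono_neutral_left) (auto simp: mconst_def)
  also have "\<dots> = 0"
  proof (rule poly_mapping_eqI)
    fix m
    have "(\<Sum>\<alpha>\<in>L. c \<alpha> * Poly_Mapping.lookup (power_product as \<alpha>) m) = 0"
    proof (cases "m \<in> M")
      case True
      then show ?thesis using w[OF r] unfolding c_def by (simp add: mult.commute)
    next
      case False
      have "Poly_Mapping.lookup (power_product as \<alpha>) m = 0" if "\<alpha> \<in> L" for \<alpha>
      proof -
        have "exponents_le (Suc n * (D * e)) (power_product as \<alpha>)"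
          using exponents_le_power_product[OF e, of \<alpha> D] that len unfolding L_def by auto
        moreover have "power_product as \<alpha> \<in> poly_ring n" by (rule power_product_in_poly_ring[OF R])
        ultimately have "m \<notin> Poly_Mapping.keys (power_product as \<alpha>)"
          using False unfolding M_def exponents_le_def poly_ring_iff by blast
        then show ?thesis by (simp add: in_keys_iff)
      qed
      then show ?thesis by simp
    qed
    then show "Poly_Mapping.lookup (\<Sum>\<alpha>\<in>L. mconst (c \<alpha>) * power_product as \<alpha>) m = Poly_Mapping.lookup 0 m"
      by (simp add: lookup_sum lookup_mconst_mult)
  qed
  finally have "(\<Sum>\<alpha>\<in>A. mconst (c \<alpha>) * power_product as \<alpha>) = 0" .
  moreover have "finite A" unfolding A_def using finL by simp
  moreover have "\<forall>\<alpha>\<in>A. length \<alpha> = length as \<and> c \<alpha> \<noteq> 0" unfolding A_def L_def len by auto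
  ultimately show ?thesis using \<open>r \<in> A\<close> by blast
qed

text \<open>One element from each of the first n + 1 gaps of a longer chain gives n + 1 polynomials
  in n variables. They satisfy an algebraic relation, yet the value of such an expression avoids the
  bottom prime and so cannot be 0.\<close>

lemma prime_chain_length_le:
  assumes "prime_chain_over n (S :: 'k::field mpoly set) m"
  shows "m \<le> n"
proof (rule ccontr)
  assume "\<not> m \<le> n"
  obtain P :: "nat \<Rightarrow> 'k mpoly set" where P: "\<And>i. i \<le> m \<Longrightarrow> prime_ideal_in n (P i)" "\<And>i. i < m \<Longrightarrow> P i \<subset> P (Suc i)"
    using assms unfolding prime_chain_over_def by blast
  have "\<forall>i. \<exists>a. i < m \<longrightarrow> a \<in> P (Suc i) - P i" using P(2) by blast
  then obtain a where a: "\<And>i. i < m \<Longrightarrow> a i \<in> P (Suc i) - P i" by metis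
  define as where "as = map a [0..<Suc n]"
  have "set as \<subseteq> poly_ring n"
  proof
    fix b assume "b \<in> set as"
    then obtain i where i: "i < Suc n" "b = a i" unfolding as_def by (auto simp del: upt_Suc)
    then have "b \<in> P (Suc i)" "Suc i \<le> m" using a[of i] \<open>\<not> m \<le> n\<close> by auto
    then show "b \<in> poly_ring n" using ideal_ofD(1)[OF prime_ideal_ideal_of[OF P(1)]] by blast
  qed
  moreover have len: "length as = Suc n" unfolding as_def by simp
  ultimately obtain A c where A: "finite A" "A \<noteq> {}" "\<forall>\<alpha>\<in>A. length \<alpha> = length as \<and> c \<alpha> \<noteq> (0::'k)"
    "(\<Sum>\<alpha>\<in>A. mconst (c \<alpha>) * power_product as \<alpha>) = 0" using algebraic_relation[of as n] by blast
  have "(\<Sum>\<alpha>\<in>A. mconst (c \<alpha>) * power_product as \<alpha>) \<notin> P 0"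
  proof (rule relation_not_in_bottom_of_chain[OF _ _ A(1,2,3)])
    show "\<forall>i\<le>length as. prime_ideal_in n (P i)" using P(1) len \<open>\<not> m \<le> n\<close> by auto
    show "\<forall>i<length as. P i \<subseteq> P (Suc i) \<and> as ! i \<in> P (Suc i) - P i"
    proof (intro allI impI)
      fix i assume "i < length as"
      then have "i < m" "as ! i = a i" using len \<open>\<not> m \<le> n\<close> unfolding as_def by (auto simp del: upt_Suc)
      then show "P i \<subseteq> P (Suc i) \<and> as ! i \<in> P (Suc i) - P i" using a P(2) by auto
    qed
  qed
  then show False using A(4) ideal_ofD(2)[OF prime_ideal_ideal_of[OF P(1)[of 0]]] by simp
qed

section \<open>Linear sections\<close>

lemma ideal_of_insert:
  fixes J :: "'k::comm_ring_1 mpoly set"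
  assumes J: "ideal_of (poly_ring n) J" and a: "a \<in> poly_ring n"
  shows "\<exists>K. ideal_of (poly_ring n) K \<and> J \<subseteq> K \<and> a \<in> K \<and>
     (\<forall>Q. ideal_of (poly_ring n) Q \<longrightarrow> J \<subseteq> Q \<longrightarrow> a \<in> Q \<longrightarrow> K \<subseteq> Q)"
proof -
  define K where "K = {p + r * a | p r. p \<in> J \<and> r \<in> poly_ring n}"
  have KI: "p + r * a \<in> K" if "p \<in> J" "r \<in> poly_ring n" for p r using that unfolding K_def by blast
  have "ideal_of (poly_ring n) K"
    unfolding ideal_of_def
  proof (intro conjI ballI)
    show "K \<subseteq> poly_ring n" unfolding K_def
      using ideal_ofD(1)[OF J] a by (auto intro!: poly_ring_simps(4,6))
    show "0 \<in> K" using KI[OF ideal_ofD(2)[OF J] poly_ring_simps(2)] by simp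
  next
    fix x y assume "x \<in> K" "y \<in> K"
    then obtain p q r s where x: "x = p + r * a" "p \<in> J" "r \<in> poly_ring n"
      and y: "y = q + s * a" "q \<in> J" "s \<in> poly_ring n" unfolding K_def by blast
    have "(p + q) + (r + s) * a \<in> K"
      using x y by (intro KI ideal_ofD(3)[OF J] poly_ring_simps(6))
    then show "x + y \<in> K" unfolding x y by (simp add: algebra_simps)
  next
    fix x t :: "'k mpoly" assume "x \<in> K" and t: "t \<in> poly_ring n"
    then obtain p r where x: "x = p + r * a" "p \<in> J" "r \<in> poly_ring n" unfolding K_def by blast
    have "t * p + (t * r) * a \<in> K"
      using x t by (intro KI ideal_ofD(4)[OF J] poly_ring_simps(4))
    then show "t * x \<in> K" unfolding x by (simp add: algebra_simps)
  qed
  moreover have "J \<subseteq> K" using KI[OF _ poly_ring_simps(2)] by auto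
  moreover have "a \<in> K" using KI[OF ideal_ofD(2)[OF J] poly_ring_simps(1)] by simp
  moreover have "K \<subseteq> Q" if Q: "ideal_of (poly_ring n) Q" "J \<subseteq> Q" "a \<in> Q" for Q
    unfolding K_def using Q by (auto intro!: ideal_ofD(3,4)[OF Q(1)])
  ultimately show ?thesis by blast
qed

text \<open>Unless \<open>J\<close> is prime or contains 1, some product a b lies in
  \<open>J\<close> with neither factor in \<open>J\<close>, and every prime over \<open>J\<close>
  contains J + (a) or J + (b), both strictly larger. The family includes all minimal primes over
  \<open>J\<close>, but its members need not be minimal.\<close>

lemma finitely_many_primes_below:
  fixes J :: "'k::field mpoly set"
  assumes "ideal_of (poly_ring n) J"
  shows "\<exists>F. finite F \<and> (\<forall>P\<in>F. prime_ideal_in n P \<and> J \<subseteq> P) \<and>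
     (\<forall>Q. prime_ideal_in n Q \<longrightarrow> J \<subseteq> Q \<longrightarrow> (\<exists>P\<in>F. P \<subseteq> Q))"
  using noetherian_poly_ring assms
proof (rule noetherian_induct)
  fix J :: "'k mpoly set" assume J: "ideal_of (poly_ring n) J"
    and IH: "\<And>K. ideal_of (poly_ring n) K \<Longrightarrow> J \<subset> K \<Longrightarrow>
      \<exists>F. finite F \<and> (\<forall>P\<in>F. prime_ideal_in n P \<and> K \<subseteq> P) \<and>
        (\<forall>Q. prime_ideal_in n Q \<longrightarrow> K \<subseteq> Q \<longrightarrow> (\<exists>P\<in>F. P \<subseteq> Q))"
  consider "prime_ideal_in n J" | "1 \<in> J"
    | a b where "a \<in> poly_ring n" "b \<in> poly_ring n" "a * b \<in> J" "a \<notin> J" "b \<notin> J"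
    using J unfolding prime_ideal_in_def ideal_of_def by blast
  then show "\<exists>F. finite F \<and> (\<forall>P\<in>F. prime_ideal_in n P \<and> J \<subseteq> P) \<and>
     (\<forall>Q. prime_ideal_in n Q \<longrightarrow> J \<subseteq> Q \<longrightarrow> (\<exists>P\<in>F. P \<subseteq> Q))"
  proof cases
    case 1
    then show ?thesis by (intro exI[of _ "{J}"]) auto
  next
    case 2
    then show ?thesis using prime_ideal_one by (intro exI[of _ "{}"]) auto
  next
    case 3
    obtain K where K: "ideal_of (poly_ring n) K" "J \<subseteq> K" "a \<in> K"
      "\<And>Q. ideal_of (poly_ring n) Q \<Longrightarrow> J \<subseteq> Q \<Longrightarrow> a \<in> Q \<Longrightarrow> K \<subseteq> Q"
      using ideal_of_insert[OF J 3(1)] by blast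
    obtain L where L: "ideal_of (poly_ring n) L" "J \<subseteq> L" "b \<in> L"
      "\<And>Q. ideal_of (poly_ring n) Q \<Longrightarrow> J \<subseteq> Q \<Longrightarrow> b \<in> Q \<Longrightarrow> L \<subseteq> Q"
      using ideal_of_insert[OF J 3(2)] by blast
    have "J \<subset> K" "J \<subset> L" using K(2,3) L(2,3) 3 by auto
    obtain F where F: "finite F" "\<And>P. P \<in> F \<Longrightarrow> prime_ideal_in n P \<and> K \<subseteq> P"
      "\<And>Q. prime_ideal_in n Q \<Longrightarrow> K \<subseteq> Q \<Longrightarrow> \<exists>P\<in>F. P \<subseteq> Q"
      using IH[OF K(1) \<open>J \<subset> K\<close>] by blast
    obtain G where G: "finite G" "\<And>P. P \<in> G \<Longrightarrow> prime_ideal_in n P \<and> L \<subseteq> P"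
      "\<And>Q. prime_ideal_in n Q \<Longrightarrow> L \<subseteq> Q \<Longrightarrow> \<exists>P\<in>G. P \<subseteq> Q"
      using IH[OF L(1) \<open>J \<subset> L\<close>] by blast
    have "\<exists>P\<in>F \<union> G. P \<subseteq> Q" if Q: "prime_ideal_in n Q" "J \<subseteq> Q" for Q
    proof -
      have "a \<in> Q \<or> b \<in> Q" using prime_ideal_multD[OF Q(1) 3(1,2)] 3(3) Q(2) by blast
      then show ?thesis
        using K(4)[OF prime_ideal_ideal_of[OF Q(1)] Q(2)] L(4)[OF prime_ideal_ideal_of[OF Q(1)] Q(2)]
          F(3)[OF Q(1)] G(3)[OF Q(1)] by blast
    qed
    moreover have "\<forall>P\<in>F \<union> G. prime_ideal_in n P \<and> J \<subseteq> P"
      using F(2) G(2) K(2) L(2) by blast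
    moreover have "finite (F \<union> G)" using F(1) G(1) by simp
    ultimately show ?thesis by (intro exI[of _ "F \<union> G"]) simp
  qed
qed

section \<open>Linear forms outside finitely many primes\<close>

definition linear_form :: "nat \<Rightarrow> (nat \<Rightarrow> 'k::comm_ring_1) \<Rightarrow> 'k mpoly" where
  "linear_form n c = (\<Sum>i<n. mconst (c i) * mvar i)"

lemma linear_form_in_poly_ring: "linear_form n c \<in> poly_ring n"
  unfolding linear_form_def by (intro poly_ring_sum poly_ring_simps mvar_in_poly_ring) auto

lemma eval_linear_form [simp]: "eval_mpoly (linear_form n c) x = (\<Sum>i<n. c i * x i)"
  unfolding linear_form_def by (simp add: eval_mpoly_sum eval_mpoly_mult)

lemma linear_form_unit: "i < n \<Longrightarrow> linear_form n (\<lambda>j. if j = i then 1 else 0) = mvar i"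
proof -
  assume "i < n"
  have "linear_form n (\<lambda>j. if j = i then 1 else (0::'a)) = (\<Sum>j<n. if j = i then mvar i else 0)"
    unfolding linear_form_def by (intro sum.cong) (auto simp: mconst_one, simp add: mconst_def)
  then show ?thesis using \<open>i < n\<close> by simp
qed

lemma linear_form_add_scale:
  "linear_form n (\<lambda>i. c i + t * d i) = linear_form n c + mconst t * linear_form n d"
proof -
  have add: "mconst (a + b) = mconst a + mconst b" for a b :: 'a
    unfolding mconst_def by (simp add: single_add)
  then show ?thesis
    unfolding linear_form_def by (simp add: add mconst_mult sum.distrib sum_distrib_left distrib_left distrib_right mult_ac)
qed

text \<open>Finitely many proper subspaces do not fill a vector space over an infinite field. If the
  form \<open>c\<close> found so far falls into the new prime \<open>P\<close>, take
  \<open>d\<close> outside \<open>P\<close> and move along \<open>d + t c\<close>: this never meets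
  \<open>P\<close>, and meets each earlier prime for at most one \<open>t\<close>, as two values
  would put \<open>c\<close> into it.\<close>

lemma linear_form_avoiding_primes:
  fixes F :: "'k::field mpoly set set"
  assumes inf: "infinite (UNIV :: 'k set)" and "finite F"
    and "\<And>P. P \<in> F \<Longrightarrow> prime_ideal_in n P \<and> (\<exists>i<n. mvar i \<notin> P)"
  shows "\<exists>c. \<forall>P\<in>F. linear_form n c \<notin> P"
  using assms(2,3)
proof (induction F)
  case empty
  show ?case by simp
next
  case (insert P F)
  then obtain c where c: "\<And>P. P \<in> F \<Longrightarrow> linear_form n c \<notin> P" by (metis insertCI)
  have P: "ideal_of (poly_ring n) P" using insert.prems prime_ideal_ideal_of by blast
  show ?case
  proof (cases "linear_form n c \<in> P")
    case False
    then show ?thesis using c by blast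
  next
    case True
    obtain i where i: "i < n" "mvar i \<notin> P" using insert.prems by blast
    define d where "d = (\<lambda>j. if j = i then 1 else (0::'k))"
    have d: "linear_form n d \<notin> P" unfolding d_def linear_form_unit[OF i(1)] by (rule i(2))
    define T where "T P' = {t. linear_form n (\<lambda>i. d i + t * c i) \<in> P'}" for P'
    have "finite (T P')" if P': "P' \<in> F" for P'
    proof -
      have id: "ideal_of (poly_ring n) P'" using insert.prems P' prime_ideal_ideal_of by blast
      have "t = t'" if t: "t \<in> T P'" "t' \<in> T P'" for t t'
      proof (rule ccontr)
        assume "t \<noteq> t'"
        have "linear_form n (\<lambda>i. d i + t * c i) = linear_form n (\<lambda>i. d i + t' * c i) + mconst (t - t') * linear_form n c"
          unfolding linear_form_add_scale[symmetric] by (simp add: algebra_simps)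
        then have "mconst (t - t') * linear_form n c =
            linear_form n (\<lambda>i. d i + t * c i) - linear_form n (\<lambda>i. d i + t' * c i)" by simp
        also have "\<dots> \<in> P'"
          using t unfolding T_def by (intro ideal_of_diff[OF is_subring_poly_ring id]) auto
        finally have "mconst (t - t') * linear_form n c \<in> P'" .
        then have "mconst (inverse (t - t')) * (mconst (t - t') * linear_form n c) \<in> P'"
          by (rule ideal_ofD(4)[OF id]) simp
        then have "linear_form n c \<in> P'"
          using \<open>t \<noteq> t'\<close> by (simp add: mult.assoc[symmetric] mconst_mult[symmetric] mconst_one)
        then show False using c[OF P'] by blast
      qed
      then have "T P' = {} \<or> (\<exists>t. T P' = {t})" by blast
      then show ?thesis by auto
    qed
    then have "finite (\<Union>P'\<in>F. T P')" using insert.hyps by blast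
    then obtain t where t: "t \<notin> (\<Union>P'\<in>F. T P')" using inf ex_new_if_finite by blast
    have "linear_form n (\<lambda>i. d i + t * c i) \<notin> P"
    proof
      assume "linear_form n (\<lambda>i. d i + t * c i) \<in> P"
      moreover have "mconst t * linear_form n c \<in> P" by (rule ideal_ofD(4)[OF P True]) simp
      ultimately have "linear_form n (\<lambda>i. d i + t * c i) - mconst t * linear_form n c \<in> P"
        by (rule ideal_of_diff[OF is_subring_poly_ring P])
      then show False using d unfolding linear_form_add_scale by simp
    qed
    then show ?thesis using t unfolding T_def by blast
  qed
qed

text \<open>The top \<open>P\<close> is recorded because the next cut extends the chain
  there.\<close>

definition prime_chain_to :: "nat \<Rightarrow> 'k::comm_ring_1 mpoly set \<Rightarrow> nat \<Rightarrow> 'k mpoly set \<Rightarrow> bool" where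
  "prime_chain_to n I j P \<longleftrightarrow> (\<exists>C. (\<forall>i\<le>j. prime_ideal_in n (C i) \<and> I \<subseteq> C i) \<and> (\<forall>i<j. C i \<subset> C (Suc i)) \<and> C j = P)"

lemma prime_chain_to_Suc:
  assumes "prime_chain_to n I j P" "prime_ideal_in n Q" "P \<subset> Q"
  shows "prime_chain_to n I (Suc j) Q"
proof -
  obtain C where C: "\<And>i. i \<le> j \<Longrightarrow> prime_ideal_in n (C i) \<and> I \<subseteq> C i" "\<And>i. i < j \<Longrightarrow> C i \<subset> C (Suc i)" "C j = P"
    using assms(1) unfolding prime_chain_to_def by blast
  have "I \<subseteq> Q" using C(1)[of j] C(3) assms(3) by blast
  then show ?thesis
    unfolding prime_chain_to_def using C assms(2,3)
    by (intro exI[of _ "C(Suc j := Q)"]) (auto simp: le_Suc_eq less_Suc_eq)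
qed

text \<open>Cutting \<open>I\<close> by linear forms one at a time, each chosen outside the finitely many relevant primes
  of the previous stage, lengthens every chain by one until its top contains all variables.\<close>

lemma linear_sections:
  fixes I :: "'k::field mpoly set"
  assumes inf: "infinite (UNIV :: 'k set)" and I: "ideal_of (poly_ring n) I"
  shows "\<exists>l F. finite F \<and> (\<forall>P\<in>F. prime_ideal_in n P \<and> ((\<forall>i<n. mvar i \<in> P) \<or> prime_chain_to n I j P)) \<and>
     (\<forall>Q. prime_ideal_in n Q \<longrightarrow> I \<subseteq> Q \<longrightarrow> (\<forall>s<j. linear_form n (l s) \<in> Q) \<longrightarrow> (\<exists>P\<in>F. P \<subseteq> Q))"
proof (induction j)
  case 0
  obtain F where F: "finite F" "\<And>P. P \<in> F \<Longrightarrow> prime_ideal_in n P \<and> I \<subseteq> P"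
    "\<And>Q. prime_ideal_in n Q \<Longrightarrow> I \<subseteq> Q \<Longrightarrow> \<exists>P\<in>F. P \<subseteq> Q"
    using finitely_many_primes_below[OF I] by blast
  have "prime_chain_to n I 0 P" if "P \<in> F" for P
    using F(2)[OF that] unfolding prime_chain_to_def by (intro exI[of _ "\<lambda>_. P"]) auto
  \<comment> \<open>No form has been imposed yet; the zero coefficients are a filler.\<close>
  then show ?case using F by (intro exI[of _ "\<lambda>_ _. 0"] exI[of _ F]) auto
next
  case (Suc j)
  then obtain l F where F': "finite F"
    "\<forall>P\<in>F. prime_ideal_in n P \<and> ((\<forall>i<n. mvar i \<in> P) \<or> prime_chain_to n I j P)"
    "\<forall>Q. prime_ideal_in n Q \<longrightarrow> I \<subseteq> Q \<longrightarrow> (\<forall>s<j. linear_form n (l s) \<in> Q) \<longrightarrow> (\<exists>P\<in>F. P \<subseteq> Q)"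
    by (elim exE conjE)
  note F = F'(1) F'(2)[THEN bspec] F'(3)[THEN spec, THEN mp, THEN mp, THEN mp]
  \<comment> \<open>A prime containing all variables is the ideal of the origin. Every linear form
    lies in it, so it cannot be cut further and is carried along unchanged.\<close>
  define F0 where "F0 = {P\<in>F. \<forall>i<n. mvar i \<in> P}"
  define F1 where "F1 = F - F0"
  have F1: "prime_ideal_in n P" "prime_chain_to n I j P" "\<exists>i<n. mvar i \<notin> P" if "P \<in> F1" for P
    using F(2) that unfolding F1_def F0_def by auto
  have "finite F1" unfolding F1_def using F(1) by simp
  then obtain c where c: "\<And>P. P \<in> F1 \<Longrightarrow> linear_form n c \<notin> P"
    using linear_form_avoiding_primes[OF inf, of F1 n] F1 by blast
  \<comment> \<open>Of the primes over \<open>P\<close> and the new form only a finite set is kept,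
    with a member below each of them, so that the next form can again avoid all that matter.\<close>
  have step: "\<forall>P\<in>F1. \<exists>G. finite G \<and> (\<forall>Q\<in>G. prime_ideal_in n Q \<and> P \<subseteq> Q \<and> linear_form n c \<in> Q) \<and>
     (\<forall>Q. prime_ideal_in n Q \<longrightarrow> P \<subseteq> Q \<longrightarrow> linear_form n c \<in> Q \<longrightarrow> (\<exists>P\<in>G. P \<subseteq> Q))"
  proof
    fix P assume P: "P \<in> F1"
    obtain K where K: "ideal_of (poly_ring n) K" "P \<subseteq> K" "linear_form n c \<in> K"
      "\<And>Q. ideal_of (poly_ring n) Q \<Longrightarrow> P \<subseteq> Q \<Longrightarrow> linear_form n c \<in> Q \<Longrightarrow> K \<subseteq> Q"
      using ideal_of_insert[OF prime_ideal_ideal_of[OF F1(1)[OF P]] linear_form_in_poly_ring] by blast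
    obtain G where G: "finite G" "\<And>Q. Q \<in> G \<Longrightarrow> prime_ideal_in n Q \<and> K \<subseteq> Q"
      "\<And>Q. prime_ideal_in n Q \<Longrightarrow> K \<subseteq> Q \<Longrightarrow> \<exists>P\<in>G. P \<subseteq> Q"
      using finitely_many_primes_below[OF K(1)] by blast
    have "\<forall>Q\<in>G. prime_ideal_in n Q \<and> P \<subseteq> Q \<and> linear_form n c \<in> Q" using G(2) K(2,3) by blast
    moreover have "\<exists>P\<in>G. P \<subseteq> Q" if Q: "prime_ideal_in n Q" "P \<subseteq> Q" "linear_form n c \<in> Q" for Q
      using G(3)[OF Q(1) K(4)[OF prime_ideal_ideal_of[OF Q(1)] Q(2,3)]] .
    ultimately show "\<exists>G. finite G \<and> (\<forall>Q\<in>G. prime_ideal_in n Q \<and> P \<subseteq> Q \<and> linear_form n c \<in> Q) \<and>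
     (\<forall>Q. prime_ideal_in n Q \<longrightarrow> P \<subseteq> Q \<longrightarrow> linear_form n c \<in> Q \<longrightarrow> (\<exists>P\<in>G. P \<subseteq> Q))"
      using G(1) by (intro exI[of _ G]) simp
  qed
  obtain G where G': "\<forall>P\<in>F1. finite (G P) \<and> (\<forall>Q\<in>G P. prime_ideal_in n Q \<and> P \<subseteq> Q \<and> linear_form n c \<in> Q) \<and>
     (\<forall>Q. prime_ideal_in n Q \<longrightarrow> P \<subseteq> Q \<longrightarrow> linear_form n c \<in> Q \<longrightarrow> (\<exists>P\<in>G P. P \<subseteq> Q))"
    using bchoice[OF step] by (elim exE)
  then have G: "\<And>P. P \<in> F1 \<Longrightarrow> finite (G P)"
    "\<And>P Q. P \<in> F1 \<Longrightarrow> Q \<in> G P \<Longrightarrow> prime_ideal_in n Q \<and> P \<subseteq> Q \<and> linear_form n c \<in> Q"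
    "\<And>P Q. P \<in> F1 \<Longrightarrow> prime_ideal_in n Q \<Longrightarrow> P \<subseteq> Q \<Longrightarrow> linear_form n c \<in> Q \<Longrightarrow> \<exists>P\<in>G P. P \<subseteq> Q"
    by simp_all
  define H where "H = F0 \<union> (\<Union>P\<in>F1. G P)"
  have "finite H" unfolding H_def F0_def using F(1) \<open>finite F1\<close> G(1) by auto
  moreover have "prime_ideal_in n Q \<and> ((\<forall>i<n. mvar i \<in> Q) \<or> prime_chain_to n I (Suc j) Q)" if QH: "Q \<in> H" for Q
  proof (cases "Q \<in> F0")
    case True
    then show ?thesis using F(2) unfolding F0_def by blast
  next
    case False
    then obtain P where P: "P \<in> F1" "Q \<in> G P" using QH unfolding H_def by blast
    have "P \<subset> Q" using G(2)[OF P] c[OF P(1)] by blast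
    then show ?thesis using prime_chain_to_Suc[OF F1(2)[OF P(1)]] G(2)[OF P] by blast
  qed
  moreover have "\<exists>P\<in>H. P \<subseteq> Q"
    if Q: "prime_ideal_in n Q" "I \<subseteq> Q" "\<forall>s<Suc j. linear_form n ((l(j := c)) s) \<in> Q" for Q
  proof -
    have "\<forall>s<j. linear_form n (l s) \<in> Q"
    proof (intro allI impI)
      fix s assume "s < j"
      then show "linear_form n (l s) \<in> Q" using Q(3)[rule_format, of s] by simp
    qed
    moreover have lc: "linear_form n c \<in> Q" using Q(3)[rule_format, of j] by simp
    ultimately obtain P where P: "P \<in> F" "P \<subseteq> Q" using F(3)[OF Q(1,2)] by blast
    show ?thesis
    proof (cases "P \<in> F0")
      case True
      then show ?thesis using P(2) unfolding H_def by blast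
    next
      case False
      then have "P \<in> F1" using P(1) unfolding F1_def by blast
      then show ?thesis using G(3)[OF _ Q(1) P(2) lc] unfolding H_def by blast
    qed
  qed
  ultimately show ?case by (intro exI[of _ "l(j := c)"] exI[of _ H]) simp
qed

section \<open>Points of Z(k) on linear subspaces\<close>

lemma prime_vanishing_ideal_point: "prime_ideal_in n (vanishing_ideal n {x :: nat \<Rightarrow> 'k::field})"
  unfolding prime_ideal_in_def vanishing_ideal_def
  using poly_ring_simps by (auto simp: eval_mpoly_add eval_mpoly_mult)

lemma ideal_of_vanishing_ideal: "ideal_of (poly_ring n) (vanishing_ideal n (X :: (nat \<Rightarrow> 'k::field) set))"
  unfolding ideal_of_def vanishing_ideal_def
  using poly_ring_simps by (auto simp: eval_mpoly_add eval_mpoly_mult)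

text \<open>Writing a monomial as a list of variables with repetition lets its factors be
  distributed over slots.\<close>

lemma monomial_as_list:
  "finite A \<Longrightarrow> \<exists>xs. length xs = (\<Sum>i\<in>A. g i) \<and> (\<forall>x :: nat \<Rightarrow> 'k::comm_ring_1. prod_list (map x xs) = (\<Prod>i\<in>A. x i ^ g i))"
proof (induction A rule: finite_induct)
  case (insert a A)
  then obtain xs where xs: "length xs = (\<Sum>i\<in>A. g i)" "\<forall>x :: nat \<Rightarrow> 'k. prod_list (map x xs) = (\<Prod>i\<in>A. x i ^ g i)" by blast
  have "prod_list (replicate k y) = y ^ k" for k and y :: 'k by (induction k) auto
  then show ?case using xs insert(1,2)
    by (intro exI[of _ "replicate (g a) a @ xs"]) (simp add: map_replicate)
qed simp

text \<open>Each monomial becomes a list of \<open>d\<close> variables, and slot \<open>l\<close>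
  feeds the one at position \<open>l\<close>. The result is not symmetric: symmetrising would
  require division by d!.\<close>

lemma homogeneous_multilinear:
  fixes f :: "'k::field mpoly"
  assumes "homogeneous d f"
  shows "\<exists>T. multilinear_on {..<d} T \<and> (\<forall>x. T (\<lambda>_. x) = eval_mpoly f x)"
proof -
  have "\<exists>xs. length xs = mon_deg m \<and> (\<forall>x :: nat \<Rightarrow> 'k. prod_list (map x xs) = mon_eval m x)" for m
    unfolding mon_deg_def mon_eval_def by (rule monomial_as_list) simp
  then obtain xs where xs: "\<And>m. length (xs m) = mon_deg m"
    "\<And>m (x :: nat \<Rightarrow> 'k). prod_list (map x (xs m)) = mon_eval m x" by metis
  define T where "T u = (\<Sum>m\<in>Poly_Mapping.keys f. Poly_Mapping.lookup f m * (\<Prod>l<d. u l (xs m ! l)))"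
    for u :: "nat \<Rightarrow> nat \<Rightarrow> 'k"
  have "multilinear_on {..<d} T"
    unfolding multilinear_on_def
  proof (intro conjI allI impI ballI)
    fix u u' :: "nat \<Rightarrow> nat \<Rightarrow> 'k" assume "\<forall>l\<in>{..<d}. u l = u' l"
    then show "T u = T u'" unfolding T_def by simp
  next
    fix l and u :: "nat \<Rightarrow> nat \<Rightarrow> 'k" and a b s t assume l: "l \<in> {..<d}"
    have P: "(\<Prod>l'<d. (u(l := v)) l' (xs m ! l')) = v (xs m ! l) * (\<Prod>l'\<in>{..<d} - {l}. u l' (xs m ! l'))" for v m
      using l by (subst prod.remove[of _ l]) auto
    show "T (u(l := \<lambda>i. s * a i + t * b i)) = s * T (u(l := a)) + t * T (u(l := b))"
      unfolding T_def P by (simp add: sum_distrib_left sum.distrib algebra_simps)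
  qed
  moreover have "T (\<lambda>_. x) = eval_mpoly f x" for x
  proof -
    have "(\<Prod>l<d. x (xs m ! l)) = mon_eval m x" if "m \<in> Poly_Mapping.keys f" for m
    proof -
      have "length (xs m) = d" using xs(1) assms that unfolding homogeneous_def by auto
      then have "(\<Prod>l<d. x (xs m ! l)) = prod_list (map x (xs m))"
        by (simp add: prod.list_conv_set_nth atLeast0LessThan)
      then show ?thesis using xs(2) by simp
    qed
    then show ?thesis unfolding T_def eval_mpoly_def mon_eval_def by simp
  qed
  ultimately show ?thesis by blast
qed

text \<open>The pullback of a form along the linear map taking coordinates on \<open>R\<close> to
  combinations of the \<open>w r\<close>, that is, its restriction to a parametrised
  subspace.\<close>

lemma multilinear_on_compose:
  assumes T: "multilinear_on E T"
  shows "multilinear_on E (\<lambda>u. T (\<lambda>l i. \<Sum>r\<in>R. u l r * w r i))"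
  unfolding multilinear_on_def
proof (intro conjI allI impI ballI)
  fix u u' :: "nat \<Rightarrow> nat \<Rightarrow> 'a" assume "\<forall>l\<in>E. u l = u' l"
  then show "T (\<lambda>l i. \<Sum>r\<in>R. u l r * w r i) = T (\<lambda>l i. \<Sum>r\<in>R. u' l r * w r i)"
    by (intro multilinear_on_cong[OF T]) simp
next
  fix l and u :: "nat \<Rightarrow> nat \<Rightarrow> 'a" and a b s t assume l: "l \<in> E"
  have U: "(\<lambda>l' i. \<Sum>r\<in>R. (u(l := v)) l' r * w r i) = (\<lambda>l' i. \<Sum>r\<in>R. u l' r * w r i)(l := (\<lambda>i. \<Sum>r\<in>R. v r * w r i))"
    for v by (rule ext) simp
  have V: "(\<lambda>i. \<Sum>r\<in>R. (s * a r + t * b r) * w r i) = (\<lambda>i. s * (\<Sum>r\<in>R. a r * w r i) + t * (\<Sum>r\<in>R. b r * w r i))"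
    by (rule ext) (simp add: sum_distrib_left sum.distrib algebra_simps)
  show "T (\<lambda>l' i. \<Sum>r\<in>R. (u(l := \<lambda>i. s * a i + t * b i)) l' r * w r i) =
    s * T (\<lambda>l' i. \<Sum>r\<in>R. (u(l := a)) l' r * w r i) + t * T (\<lambda>l' i. \<Sum>r\<in>R. (u(l := b)) l' r * w r i)"
    unfolding U V by (rule multilinear_on_slot[OF T l])
qed

text \<open>Such a polynomial is constant, and a nonzero constant is a unit, which no proper ideal
  contains. Degree 0 is treated apart because homogeneity then gives no zero at the origin.\<close>

lemma homogeneous_0_in_prime:
  fixes f :: "'k::field mpoly"
  assumes f: "homogeneous 0 f" and P: "prime_ideal_in n P" "f \<in> P"
  shows "f = 0"
proof -
  have "m = 0" if "m \<in> Poly_Mapping.keys f" for m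
  proof (rule poly_mapping_eqI)
    fix i
    have "mon_deg m = 0" using f that unfolding homogeneous_def by blast
    then show "Poly_Mapping.lookup m i = Poly_Mapping.lookup 0 i"
      unfolding mon_deg_def by (cases "i \<in> Poly_Mapping.keys m") (auto simp: in_keys_iff)
  qed
  then have "f \<in> poly_ring 0" unfolding poly_ring_iff by auto
  then have eq: "f = mconst (Poly_Mapping.lookup f 0)" by (rule poly_ring_0)
  then have "Poly_Mapping.lookup f 0 = 0"
    using ideal_of_poly_ring_unit[OF prime_ideal_ideal_of[OF P(1)]] P(2) prime_ideal_one[OF P(1)] by metis
  then show ?thesis using eq by (simp add: mconst_def)
qed

text \<open>The common kernel of \<open>j\<close> linear forms has at least \<open>n - j > N\<close>
  free coordinates, and on it the system becomes one of the same degrees in these coordinates. Only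
  the number and the maximum of the degrees enter \<open>N\<close>.\<close>

lemma kpoints_linear_section:
  fixes ds :: "nat list"
  assumes brauer: "brauer_field TYPE('k::field)"
  shows "\<exists>N. \<forall>n j (l :: nat \<Rightarrow> nat \<Rightarrow> 'k) (fs :: 'k mpoly list).
     length fs = length ds \<longrightarrow> (\<forall>i<length fs. homogeneous (ds ! i) (fs ! i)) \<longrightarrow>
     (\<forall>i<length fs. ds ! i = 0 \<longrightarrow> fs ! i = 0) \<longrightarrow> j + N < n \<longrightarrow>
     (\<exists>x\<in>kpoints n fs. (\<exists>i<n. x i \<noteq> 0) \<and> (\<forall>s<j. (\<Sum>i<n. l s i * x i) = 0))"
proof -
  define d where "d = Max (insert 0 (set ds))"
  have d: "ds ! i \<le> d" if "i < length ds" for i unfolding d_def using that by (intro Max_ge) auto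
  define q where "q = length ds"
  obtain N where N: "\<And>S :: 'k form_system. forms_upto d q q S \<Longrightarrow> solvable_beyond N S"
    using brauer_forms[OF brauer] by blast
  show ?thesis
  proof (intro exI[of _ N] allI impI)
    fix n j and l :: "nat \<Rightarrow> nat \<Rightarrow> 'k" and fs :: "'k mpoly list"
    assume len: "length fs = length ds" and hom: "\<forall>i<length fs. homogeneous (ds ! i) (fs ! i)"
      and zero: "\<forall>i<length fs. ds ! i = 0 \<longrightarrow> fs ! i = 0" and n: "j + N < n"
    have "\<forall>i. \<exists>T. i < length fs \<longrightarrow> multilinear_on {..<ds ! i} T \<and> (\<forall>x. T (\<lambda>_. x) = eval_mpoly (fs ! i) x)"
      using homogeneous_multilinear hom by blast
    then obtain T where T: "\<And>i. i < length fs \<Longrightarrow> multilinear_on {..<ds ! i} (T i)"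
      "\<And>i x. i < length fs \<Longrightarrow> T i (\<lambda>_. x) = eval_mpoly (fs ! i) x" by metis
    obtain R w where R: "R \<subseteq> {..<n}" "card {..<n} \<le> card R + card {..<j}"
      and w: "\<forall>r\<in>R. (\<forall>s\<in>{..<j}. (\<Sum>i\<in>{..<n}. l s i * w r i) = 0) \<and> (\<forall>i. i \<notin> {..<n} \<longrightarrow> w r i = 0) \<and>
        (\<forall>r'\<in>R. w r r' = (if r = r' then 1 else 0))"
      using common_kernel[of "{..<j}" "{..<n}" l, OF finite_lessThan finite_lessThan] by (elim exE conjE)
    have finR: "finite R" using R(1) finite_subset by blast
    have cardR: "N < card R" using R(2) n by simp
    \<comment> \<open>Slot sets must be nonempty, so degree 0 is left out here; those polynomials
      are zero by assumption.\<close>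
    define I where "I = {i. i < length fs \<and> ds ! i \<noteq> 0}"
    define S where "S = (\<lambda>i. ({..<ds ! i}, \<lambda>u. T i (\<lambda>l i. \<Sum>r\<in>R. u l r * w r i))) ` I"
    have I: "I \<subseteq> {..<length fs}" unfolding I_def by auto
    then have finI: "finite I" using finite_subset by blast
    have "card I \<le> q" using card_mono[OF _ I] len unfolding q_def by simp
    then have cS: "card S \<le> q" unfolding S_def using card_image_le[OF finI] le_trans by blast
    have finS: "finite S" unfolding S_def using finI by simp
    have "forms_upto d q q S"
      unfolding forms_upto_def
    proof (intro conjI ballI)
      show "card {s\<in>S. card (fst s) = d} \<le> q"
        using card_mono[OF finS, of "{s\<in>S. card (fst s) = d}"] cS by auto
    next
      fix s assume "s \<in> S"
      then obtain i where i: "i < length fs" "ds ! i \<noteq> 0"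
        "s = ({..<ds ! i}, \<lambda>u. T i (\<lambda>l i. \<Sum>r\<in>R. u l r * w r i))" unfolding S_def I_def by auto
      show "finite (fst s)" using i(3) by simp
      show "fst s \<noteq> {}" using i(2,3) by auto
      show "card (fst s) \<le> d" using d[of i] i(1,3) len by simp
      show "multilinear_on (fst s) (snd s)" using multilinear_on_compose[OF T(1)[OF i(1)]] i(3) by simp
    qed (fact finS, fact cS)
    from N[OF this, unfolded solvable_beyond_def, rule_format, OF finR cardR] obtain v where
      "(\<forall>i. i \<notin> R \<longrightarrow> v i = 0) \<and> (\<exists>i. v i \<noteq> 0) \<and> (\<forall>s\<in>S. snd s (\<lambda>_. v) = 0)"
      by (elim exE)
    then have v: "\<And>i. i \<notin> R \<Longrightarrow> v i = 0" "\<exists>i. v i \<noteq> 0" "\<And>s. s \<in> S \<Longrightarrow> snd s (\<lambda>_. v) = 0"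
      by simp_all
    define x where "x i = (\<Sum>r\<in>R. v r * w r i)" for i
    \<comment> \<open>\<open>w\<close> is the identity matrix on \<open>R\<close>, so
      \<open>v\<close> is recovered from \<open>x\<close>; hence \<open>x\<close> is
      nonzero.\<close>
    have x_R: "x r' = v r'" if "r' \<in> R" for r'
    proof -
      have "x r' = (\<Sum>r\<in>R. if r = r' then v r' else 0)"
        unfolding x_def using w that by (intro sum.cong) auto
      then show ?thesis using finR that by simp
    qed
    show "\<exists>x\<in>kpoints n fs. (\<exists>i<n. x i \<noteq> 0) \<and> (\<forall>s<j. (\<Sum>i<n. l s i * x i) = 0)"
    proof (intro bexI[of _ x] conjI allI impI)
      obtain r where r: "v r \<noteq> 0" using v(2) by blast
      then have "r \<in> R" using v(1) by blast
      then show "\<exists>i<n. x i \<noteq> 0" using r x_R R(1) by force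
    next
      fix s assume "s < j"
      have "(\<Sum>i<n. l s i * x i) = (\<Sum>i<n. \<Sum>r\<in>R. v r * (l s i * w r i))"
        unfolding x_def by (simp add: sum_distrib_left mult_ac)
      also have "\<dots> = (\<Sum>r\<in>R. v r * (\<Sum>i<n. l s i * w r i))"
        by (subst sum.swap) (simp add: sum_distrib_left)
      also have "\<dots> = 0" using w \<open>s < j\<close> by simp
      finally show "(\<Sum>i<n. l s i * x i) = 0" .
    next
      have "x i = 0" if "i \<ge> n" for i unfolding x_def using w that by simp
      moreover have "eval_mpoly f x = 0" if f: "f \<in> set fs" for f
      proof -
        obtain i where i: "i < length fs" "f = fs ! i" using f by (auto simp: in_set_conv_nth)
        show ?thesis
        proof (cases "ds ! i = 0")
          case True
          then show ?thesis using zero i by simp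
        next
          case False
          then have "({..<ds ! i}, \<lambda>u. T i (\<lambda>l i. \<Sum>r\<in>R. u l r * w r i)) \<in> S"
            using i(1) unfolding S_def I_def by (intro imageI) simp
          from v(3)[OF this] have "T i (\<lambda>_ i. \<Sum>r\<in>R. v r * w r i) = 0" by simp
          then show ?thesis using T(2)[OF i(1), of x] i(2) unfolding x_def by simp
        qed
      qed
      ultimately show "x \<in> kpoints n fs" unfolding kpoints_def by blast
    qed
  qed
qed

theorem theorem1p3:
  fixes ds :: "nat list"
  assumes inf: "infinite (UNIV :: 'k::field set)"
    and brauer: "brauer_field TYPE('k)"
  shows "\<exists>C::nat. \<forall>(n::nat) (fs :: 'k mpoly list).
           length fs = length ds \<longrightarrow>
           (\<forall>i<length fs. fs ! i \<in> poly_ring n \<and> homogeneous (ds ! i) (fs ! i)) \<longrightarrow>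
           (\<forall>m. prime_chain_over n (set fs) m \<longrightarrow>
              (\<exists>m'. prime_chain_over n (vanishing_ideal n (kpoints n fs)) m' \<and> m \<le> m' + C))"
proof -
  obtain N where N: "\<And>n j (l :: nat \<Rightarrow> nat \<Rightarrow> 'k) (fs :: 'k mpoly list).
     length fs = length ds \<Longrightarrow> (\<forall>i<length fs. homogeneous (ds ! i) (fs ! i)) \<Longrightarrow>
     (\<forall>i<length fs. ds ! i = 0 \<longrightarrow> fs ! i = 0) \<Longrightarrow> j + N < n \<Longrightarrow>
     (\<exists>x\<in>kpoints n fs. (\<exists>i<n. x i \<noteq> 0) \<and> (\<forall>s<j. (\<Sum>i<n. l s i * x i) = 0))"
    using kpoints_linear_section[OF brauer, of ds] by blast
  show ?thesis
  \<comment> \<open>A point on the section is available for \<open>j + N < n\<close>, so n - N - 1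
    is the largest number of cuts.\<close>
  proof (rule exI[of _ "Suc N"], intro allI impI)
    fix n and fs :: "'k mpoly list" and m
    assume len: "length fs = length ds"
      and fs: "\<forall>i<length fs. fs ! i \<in> poly_ring n \<and> homogeneous (ds ! i) (fs ! i)"
      and chain: "prime_chain_over n (set fs) m"
    define I where "I = vanishing_ideal n (kpoints n fs)"
    have "m \<le> n" by (rule prime_chain_length_le[OF chain])
    \<comment> \<open>A chain to be matched supplies a prime containing the system, which forces the
      forms of degree 0 to vanish.\<close>
    obtain P where P: "prime_ideal_in n P" "set fs \<subseteq> P"
      using chain unfolding prime_chain_over_def by blast
    have zero: "\<forall>i<length fs. ds ! i = 0 \<longrightarrow> fs ! i = 0"
    proof (intro allI impI)
      fix i assume i: "i < length fs" "ds ! i = 0"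
      then have "homogeneous 0 (fs ! i)" "fs ! i \<in> P" using fs P(2) nth_mem by fastforce+
      then show "fs ! i = 0" using homogeneous_0_in_prime[OF _ P(1)] by blast
    qed
    show "\<exists>m'. prime_chain_over n (vanishing_ideal n (kpoints n fs)) m' \<and> m \<le> m' + Suc N"
    proof (cases "n \<le> Suc N")
      \<comment> \<open>Here \<open>m \<le> n \<le> Suc N\<close>, so a chain of length 0 suffices;
        the ideal of the origin provides it.\<close>
      case True
      have "eval_mpoly (fs ! i) (\<lambda>_. 0) = 0" if i: "i < length fs" for i
      proof (cases "ds ! i = 0")
        case False
        obtain T where T: "multilinear_on {..<ds ! i} T" "\<And>x. T (\<lambda>_. x) = eval_mpoly (fs ! i) x"
          using homogeneous_multilinear fs i by blast
        \<comment> \<open>An empty sum in slot 0 yields that the zero vector there gives the value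
          0. Slot 0 exists because the degree is positive.\<close>
        have "T ((\<lambda>_ _. 0)(0 := (\<lambda>_. \<Sum>j\<in>({}::nat set). 0 * 0))) = (\<Sum>j\<in>({}::nat set). 0 * T ((\<lambda>_ _. 0)(0 := \<lambda>_. 0)))"
          using False by (intro multilinear_on_slot_sum[OF T(1)]) auto
        then have "T (\<lambda>_ _. 0) = 0" by (simp add: fun_upd_idem)
        then show ?thesis using T(2) by metis
      qed (use zero i in simp)
      then have "(\<lambda>_. 0) \<in> kpoints n fs" unfolding kpoints_def by (auto simp: in_set_conv_nth)
      then have "I \<subseteq> vanishing_ideal n {\<lambda>_. 0}" unfolding I_def vanishing_ideal_def by blast
      then have "prime_chain_over n I 0"
        unfolding prime_chain_over_def using prime_vanishing_ideal_point
        by (intro exI[of _ "\<lambda>_. vanishing_ideal n {\<lambda>_. 0}"]) simp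
      then show ?thesis using True \<open>m \<le> n\<close> unfolding I_def by (intro exI[of _ 0]) simp
    next
      case False
      define j where "j = n - Suc N"
      have "ideal_of (poly_ring n) I" unfolding I_def by (rule ideal_of_vanishing_ideal)
      from linear_sections[OF inf this, of j] obtain l F where
        F1: "\<forall>P\<in>F. prime_ideal_in n P \<and> ((\<forall>i<n. mvar i \<in> P) \<or> prime_chain_to n I j P)" and
        F2: "\<forall>Q. prime_ideal_in n Q \<longrightarrow> I \<subseteq> Q \<longrightarrow> (\<forall>s<j. linear_form n (l s) \<in> Q) \<longrightarrow> (\<exists>P\<in>F. P \<subseteq> Q)"
        by (elim exE conjE)
      have "j + N < n" using False unfolding j_def by simp
      then obtain x where x: "x \<in> kpoints n fs" "\<exists>i<n. x i \<noteq> 0" "\<forall>s<j. (\<Sum>i<n. l s i * x i) = 0"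
        using N[OF len _ zero] fs by blast
      define Q where "Q = vanishing_ideal n {x}"
      have "prime_ideal_in n Q" unfolding Q_def by (rule prime_vanishing_ideal_point)
      moreover have "I \<subseteq> Q" using x(1) unfolding I_def Q_def vanishing_ideal_def by blast
      moreover have "\<forall>s<j. linear_form n (l s) \<in> Q"
        using x(3) linear_form_in_poly_ring unfolding Q_def vanishing_ideal_def by auto
      ultimately obtain P where P: "P \<in> F" "P \<subseteq> Q" using F2 by blast
      \<comment> \<open>A nonzero coordinate of \<open>x\<close> keeps its variable out of
        \<open>Q\<close>, hence out of \<open>P\<close>. This rules out the ideal of the origin, so
        \<open>P\<close> is the top of a chain of length \<open>j\<close>.\<close>
      have "\<exists>i<n. mvar i \<notin> P"
        using x(2) P(2) unfolding Q_def vanishing_ideal_def by auto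
      then have "prime_chain_to n I j P" using F1 P(1) by blast
      then have "prime_chain_over n I j" unfolding prime_chain_to_def prime_chain_over_def by blast
      moreover have "m \<le> j + Suc N" using \<open>m \<le> n\<close> unfolding j_def by simp
      ultimately show ?thesis unfolding I_def by blast
    qed
  qed
qed

end
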